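(* Let $(\boldsymbol{x},\boldsymbol{n},\boldsymbol{s}):U\to\mathbb{R}^3\times\Delta$ be a framed surface with basic invariants $a_i,b_i,e_i,f_i,g_i$ ($i=1,2$), and let $(u_0,v_0)\in U$. (1) Suppose that $b_1g_2-b_2g_1=0$ on $U$, let $\theta^{s,n}:U\to\mathbb{R}$ be a smooth function, let $$\lambda^{s,n}(u,v)=-\left(\int_{u_0}^{u}a_1(u,v)\,du+\int_{v_0}^{v}a_2(u_0,v)\,dv\right),$$ and form $\mathcal{I}^s(\boldsymbol{x},\boldsymbol{n},\boldsymbol{s})$ with these. Then $(\boldsymbol{x},\boldsymbol{n},\boldsymbol{s})$ is an $(\boldsymbol{s},\overline{\boldsymbol{s}})$-Bertrand framed surface if and only if there exists a smooth function $\lambda^{n,s}:U\to\mathbb{R}$ with $\lambda^{n,s}+\lambda^{s,n}\not\equiv0$ such that $\mathcal{C}^{s}$ of $\mathcal{I}^{s}(\boldsymbol{x},\boldsymbol{n},\boldsymbol{s})$ exists with this $\lambda^{n,s}$ (that is, for some smooth $\theta^{n,s}:U\to\mathbb{R}$ the pair $(\lambda^{n,s},\theta^{n,s})$ satisfies the condition required to form $\mathcal{C}^s$ of $\mathcal{I}^s(\boldsymbol{x},\boldsymbol{n},\boldsymbol{s})$). Moreover, in this case $(\boldsymbol{x},\boldsymbol{n},\boldsymbol{s})$ and $\mathcal{C}^{s}(\mathcal{I}^{s}(\boldsymbol{x},\boldsymbol{n},\boldsymbol{s}))$ are $(\boldsymbol{s},\overline{\boldsymbol{s}})$-mates. (2)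 Suppose that $a_1g_2-a_2g_1=0$ on $U$, let $\theta^{t,n}:U\to\mathbb{R}$ be a smooth function, let $$\lambda^{t,n}(u,v)=-\left(\int_{u_0}^{u}b_1(u,v)\,du+\int_{v_0}^{v}b_2(u_0,v)\,dv\right),$$ and form $\mathcal{I}^t(\boldsymbol{x},\boldsymbol{n},\boldsymbol{s})$ with these. Then $(\boldsymbol{x},\boldsymbol{n},\boldsymbol{s})$ is a $(\boldsymbol{t},\overline{\boldsymbol{t}})$-Bertrand framed surface if and only if there exists a smooth function $\lambda^{n,t}:U\to\mathbb{R}$ with $\lambda^{n,t}+\lambda^{t,n}\not\equiv0$ such that $\mathcal{C}^{t}$ of $\mathcal{I}^{t}(\boldsymbol{x},\boldsymbol{n},\boldsymbol{s})$ exists with this $\lambda^{n,t}$ (that is, for some smooth $\theta^{n,t}:U\to\mathbb{R}$ the pair $(\lambda^{n,t},\theta^{n,t})$ satisfies the condition required to form $\mathcal{C}^t$ of $\mathcal{I}^t(\boldsymbol{x},\boldsymbol{n},\boldsymbol{s})$). Moreover, in this case $(\boldsymbol{x},\boldsymbol{n},\boldsymbol{s})$ and $\mathcal{C}^{t}(\mathcal{I}^{t}(\boldsymbol{x},\boldsymbol{n},\boldsymbol{s}))$ are $(\boldsymbol{t},\overline{\boldsymbol{t}})$-mates.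
   Context: All maps are $C^\infty$. $U\subset\mathbb{R}^2$ is a simply connected domain with coordinates $(u,v)$, $S^2$ is the unit sphere in $\mathbb{R}^3$, and $\Delta=\{(\boldsymbol{a},\boldsymbol{b})\in S^2\times S^2 : \boldsymbol{a}\cdot\boldsymbol{b}=0\}$. A framed surface is a smooth map $(\boldsymbol{x},\boldsymbol{n},\boldsymbol{s}):U\to\mathbb{R}^3\times\Delta$ with $\boldsymbol{x}_u\cdot\boldsymbol{n}=\boldsymbol{x}_v\cdot\boldsymbol{n}=0$ on $U$. Put $\boldsymbol{t}=\boldsymbol{n}\times\boldsymbol{s}$. Its basic invariants are the smooth functions $a_i,b_i,e_i,f_i,g_i:U\to\mathbb{R}$ ($i=1,2$) determined by $\boldsymbol{x}_u=a_1\boldsymbol{s}+b_1\boldsymbol{t}$, $\boldsymbol{n}_u=e_1\boldsymbol{s}+f_1\boldsymbol{t}$, $\boldsymbol{s}_u=-e_1\boldsymbol{n}+g_1\boldsymbol{t}$, $\boldsymbol{t}_u=-f_1\boldsymbol{n}-g_1\boldsymbol{s}$, and the same equations with $\partial_v$ in place of $\partial_u$ and index $2$ in place of $1$. Integrability gives $(a_1)_v-(a_2)_u=b_1g_2-b_2g_1$ and $(b_1)_v-(b_2)_u=a_2g_1-a_1g_2$. For a smooth $\lambda:U\to\mathbb{R}$, $\lambda\not\equiv0$ means that $\{(u,v)\in U:\lambda(u,v)\neq0\}$ is dense in $U$. Two framed surfaces $(\boldsymbol{x},\boldsymbol{n},\boldsymbol{s}),(\overline{\boldsymbol{x}},\overline{\boldsymbol{n}},\overline{\boldsymbol{s}}):U\to\mathbb{R}^3\times\Delta$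 (with $\overline{\boldsymbol{t}}=\overline{\boldsymbol{n}}\times\overline{\boldsymbol{s}}$) are $(\boldsymbol{v},\overline{\boldsymbol{w}})$-mates, where each of $\boldsymbol{v},\boldsymbol{w}$ is one of $\boldsymbol{n},\boldsymbol{s},\boldsymbol{t}$, if there is a smooth $\lambda:U\to\mathbb{R}$ with $\lambda\not\equiv0$ such that $\overline{\boldsymbol{x}}=\boldsymbol{x}+\lambda\boldsymbol{v}$ and $\boldsymbol{v}=\overline{\boldsymbol{w}}$ on $U$. $(\boldsymbol{x},\boldsymbol{n},\boldsymbol{s})$ is a $(\boldsymbol{v},\overline{\boldsymbol{w}})$-Bertrand framed surface if there is a framed surface $(\overline{\boldsymbol{x}},\overline{\boldsymbol{n}},\overline{\boldsymbol{s}}):U\to\mathbb{R}^3\times\Delta$ such that the two are $(\boldsymbol{v},\overline{\boldsymbol{w}})$-mates. The operations below send a framed surface (with the indicated auxiliary choices) to a framed surface; when an operation is applied to another framed surface, the invariants and frame vectors $\boldsymbol{n},\boldsymbol{s},\boldsymbol{t}$ in its definition are those of that framed surface. Caustics. $\mathcal{C}^{s}(\boldsymbol{x},\boldsymbol{n},\boldsymbol{s})=(\boldsymbol{x}+\lambda^{n,s}\boldsymbol{n},\ \sin\theta^{n,s}\boldsymbol{s}+\cos\theta^{n,s}\boldsymbol{t},\ \boldsymbol{n})$, where $\lambda^{n,s},\theta^{n,s}:U\to\mathbb{R}$ are smooth functions satisfying $(a_i+\lambda^{n,s}e_i)\sin\theta^{n,s}+(b_i+\lambda^{n,s}f_i)\cos\theta^{n,s}=0$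 on $U$ for $i=1,2$. $\mathcal{C}^{t}(\boldsymbol{x},\boldsymbol{n},\boldsymbol{s})=(\boldsymbol{x}+\lambda^{n,t}\boldsymbol{n},\ \cos\theta^{n,t}\boldsymbol{s}-\sin\theta^{n,t}\boldsymbol{t},\ \sin\theta^{n,t}\boldsymbol{s}+\cos\theta^{n,t}\boldsymbol{t})$, where $\lambda^{n,t},\theta^{n,t}:U\to\mathbb{R}$ are smooth functions satisfying $-(a_i+\lambda^{n,t}e_i)\cos\theta^{n,t}+(b_i+\lambda^{n,t}f_i)\sin\theta^{n,t}=0$ on $U$ for $i=1,2$. Involutes at $(u_0,v_0)\in U$. If $b_1g_2-b_2g_1=0$ on $U$, $\mathcal{I}^{s}(\boldsymbol{x},\boldsymbol{n},\boldsymbol{s})=(\boldsymbol{x}+\lambda^{s,n}\boldsymbol{s},\ \boldsymbol{s},\ \cos\theta^{s,n}\boldsymbol{t}-\sin\theta^{s,n}\boldsymbol{n})$, where $\theta^{s,n}:U\to\mathbb{R}$ is a smooth function and $\lambda^{s,n}$ is the function displayed in part (1) of the claim. If $a_1g_2-a_2g_1=0$ on $U$, $\mathcal{I}^{t}(\boldsymbol{x},\boldsymbol{n},\boldsymbol{s})=(\boldsymbol{x}+\lambda^{t,n}\boldsymbol{t},\ \boldsymbol{t},\ \cos\theta^{t,n}\boldsymbol{n}-\sin\theta^{t,n}\boldsymbol{s})$, where $\theta^{t,n}:U\to\mathbb{R}$ is a smooth function and $\lambda^{t,n}$ is the function displayed in part (2) of the claim. These integrals are integrals of the closed 1-forms $a_1du+a_2dv$,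 $b_1du+b_2dv$ along the path from $(u_0,v_0)$ to $(u_0,v)$ to $(u,v)$; if this path is not contained in $U$, they are read as integrals along any path in $U$ from $(u_0,v_0)$ to $(u,v)$. *)

theory Defs
  imports "HOL-Analysis.Analysis"
begin

section \<open>Smooth functions and partial derivatives\<close>

(* All functions are total; only their values on the open set U matter. *)

(* C^k on an open set, by recursion through directional derivatives. *)
primrec Ck_on :: "nat \<Rightarrow> 'a::real_normed_vector set \<Rightarrow> ('a \<Rightarrow> 'b::real_normed_vector) \<Rightarrow> bool" where
  "Ck_on 0 U f \<longleftrightarrow> continuous_on U f"
| "Ck_on (Suc k) U f \<longleftrightarrow>
     (\<forall>p\<in>U. f differentiable (at p)) \<and> (\<forall>h. Ck_on k U (\<lambda>p. frechet_derivative f (at p) h))"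

definition smooth_on :: "'a::real_normed_vector set \<Rightarrow> ('a \<Rightarrow> 'b::real_normed_vector) \<Rightarrow> bool" where
  "smooth_on U f \<longleftrightarrow> (\<forall>k. Ck_on k U f)"

(* partial 1 is the derivative in u, partial 2 the derivative in v. *)
definition partial :: "nat \<Rightarrow> (real \<times> real \<Rightarrow> 'b::real_normed_vector) \<Rightarrow> real \<times> real \<Rightarrow> 'b" where
  "partial i f p =
     (if i = 1 then vector_derivative (\<lambda>u. f (u, snd p)) (at (fst p))
      else vector_derivative (\<lambda>v. f (fst p, v)) (at (snd p)))"

(* The relation written "lambda not identically 0": much stronger than not vanishing identically. *)
definition densely_nonzero :: "(real \<times> real) set \<Rightarrow> (real \<times> real \<Rightarrow> real) \<Rightarrow> bool" where
  "densely_nonzero U l \<longleftrightarrow> U \<subseteq> closure {p \<in> U. l p \<noteq> 0}"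

section \<open>Framed surfaces and basic invariants\<close>

(* A triple (x, n, s) of vector-valued functions. *)
type_synonym frame_map =
  "(real \<times> real \<Rightarrow> real ^ 3) \<times> (real \<times> real \<Rightarrow> real ^ 3) \<times> (real \<times> real \<Rightarrow> real ^ 3)"

definition Delta :: "((real ^ 3) \<times> (real ^ 3)) set" where
  "Delta = {(a, b). a \<in> sphere 0 1 \<and> b \<in> sphere 0 1 \<and> a \<bullet> b = 0}"

fun framed_surface :: "(real \<times> real) set \<Rightarrow> frame_map \<Rightarrow> bool" where
  "framed_surface U (x, n, s) \<longleftrightarrow>
     smooth_on U x \<and> smooth_on U n \<and> smooth_on U s \<and>
     (\<forall>p\<in>U. (n p, s p) \<in> Delta \<and> partial 1 x p \<bullet> n p = 0 \<and> partial 2 x p \<bullet> n p = 0)"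

datatype frame_dir = Dir_n | Dir_s | Dir_t

fun frame_vec :: "frame_map \<Rightarrow> frame_dir \<Rightarrow> real \<times> real \<Rightarrow> real ^ 3" where
  "frame_vec (x, n, s) Dir_n p = n p"
| "frame_vec (x, n, s) Dir_s p = s p"
| "frame_vec (x, n, s) Dir_t p = cross3 (n p) (s p)"

(* On U these functions are uniquely determined, because (n, s, t) is an orthonormal frame. *)
definition basic_invariants ::
  "(real \<times> real) set \<Rightarrow> frame_map \<Rightarrow>
   (nat \<Rightarrow> real \<times> real \<Rightarrow> real) \<Rightarrow> (nat \<Rightarrow> real \<times> real \<Rightarrow> real) \<Rightarrow> (nat \<Rightarrow> real \<times> real \<Rightarrow> real) \<Rightarrow>
   (nat \<Rightarrow> real \<times> real \<Rightarrow> real) \<Rightarrow> (nat \<Rightarrow> real \<times> real \<Rightarrow> real) \<Rightarrow> bool" where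
  "basic_invariants U F a b e f g \<longleftrightarrow>
     framed_surface U F \<and>
     (let x = fst F; n = frame_vec F Dir_n; s = frame_vec F Dir_s; t = frame_vec F Dir_t in
      \<forall>i\<in>{1, 2}.
        smooth_on U (a i) \<and> smooth_on U (b i) \<and> smooth_on U (e i) \<and>
        smooth_on U (f i) \<and> smooth_on U (g i) \<and>
        (\<forall>p\<in>U.
          partial i x p = a i p *\<^sub>R s p + b i p *\<^sub>R t p \<and>
          partial i n p = e i p *\<^sub>R s p + f i p *\<^sub>R t p \<and>
          partial i s p = - e i p *\<^sub>R n p + g i p *\<^sub>R t p \<and>
          partial i t p = - f i p *\<^sub>R n p - g i p *\<^sub>R s p))"

section \<open>Mates and Bertrand framed surfaces\<close>

(* mates U v w F G: F and G are (v, w-bar)-mates, where w-bar is the vector w of G. *)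
definition mates ::
  "(real \<times> real) set \<Rightarrow> frame_dir \<Rightarrow> frame_dir \<Rightarrow> frame_map \<Rightarrow> frame_map \<Rightarrow> bool" where
  "mates U v w F G \<longleftrightarrow>
     framed_surface U F \<and> framed_surface U G \<and>
     (\<exists>l. smooth_on U l \<and> densely_nonzero U l \<and>
       (\<forall>p\<in>U. fst G p = fst F p + l p *\<^sub>R frame_vec F v p \<and> frame_vec F v p = frame_vec G w p))"

definition bertrand ::
  "(real \<times> real) set \<Rightarrow> frame_dir \<Rightarrow> frame_dir \<Rightarrow> frame_map \<Rightarrow> bool" where
  "bertrand U v w F \<longleftrightarrow> (\<exists>G. mates U v w F G)"

section \<open>Caustics\<close>

definition caustic_s :: "(real \<times> real \<Rightarrow> real) \<Rightarrow> (real \<times> real \<Rightarrow> real) \<Rightarrow> frame_map \<Rightarrow> frame_map" where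
  "caustic_s l \<theta> F =
     (\<lambda>p. fst F p + l p *\<^sub>R frame_vec F Dir_n p,
      \<lambda>p. sin (\<theta> p) *\<^sub>R frame_vec F Dir_s p + cos (\<theta> p) *\<^sub>R frame_vec F Dir_t p,
      \<lambda>p. frame_vec F Dir_n p)"

definition caustic_s_cond ::
  "(real \<times> real) set \<Rightarrow> (real \<times> real \<Rightarrow> real) \<Rightarrow> (real \<times> real \<Rightarrow> real) \<Rightarrow> frame_map \<Rightarrow> bool" where
  "caustic_s_cond U l \<theta> F \<longleftrightarrow>
     smooth_on U l \<and> smooth_on U \<theta> \<and>
     (\<exists>a b e f g. basic_invariants U F a b e f g \<and>
       (\<forall>i\<in>{1, 2}. \<forall>p\<in>U.
          (a i p + l p * e i p) * sin (\<theta> p) + (b i p + l p * f i p) * cos (\<theta> p) = 0))"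

definition caustic_t :: "(real \<times> real \<Rightarrow> real) \<Rightarrow> (real \<times> real \<Rightarrow> real) \<Rightarrow> frame_map \<Rightarrow> frame_map" where
  "caustic_t l \<theta> F =
     (\<lambda>p. fst F p + l p *\<^sub>R frame_vec F Dir_n p,
      \<lambda>p. cos (\<theta> p) *\<^sub>R frame_vec F Dir_s p - sin (\<theta> p) *\<^sub>R frame_vec F Dir_t p,
      \<lambda>p. sin (\<theta> p) *\<^sub>R frame_vec F Dir_s p + cos (\<theta> p) *\<^sub>R frame_vec F Dir_t p)"

definition caustic_t_cond ::
  "(real \<times> real) set \<Rightarrow> (real \<times> real \<Rightarrow> real) \<Rightarrow> (real \<times> real \<Rightarrow> real) \<Rightarrow> frame_map \<Rightarrow> bool" where
  "caustic_t_cond U l \<theta> F \<longleftrightarrow>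
     smooth_on U l \<and> smooth_on U \<theta> \<and>
     (\<exists>a b e f g. basic_invariants U F a b e f g \<and>
       (\<forall>i\<in>{1, 2}. \<forall>p\<in>U.
          - (a i p + l p * e i p) * cos (\<theta> p) + (b i p + l p * f i p) * sin (\<theta> p) = 0))"

section \<open>Involutes\<close>

definition line_integral ::
  "(real \<times> real \<Rightarrow> real) \<Rightarrow> (real \<times> real \<Rightarrow> real) \<Rightarrow> (real \<Rightarrow> real \<times> real) \<Rightarrow> real" where
  "line_integral A1 A2 \<gamma> =
     integral {0..1}
       (\<lambda>r. A1 (\<gamma> r) * fst (vector_derivative \<gamma> (at r)) + A2 (\<gamma> r) * snd (vector_derivative \<gamma> (at r)))"

(* The integral of the closed form A1 du + A2 dv from (u0, v0) to (u, v): along the path through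
   (u0, v) if that path stays in U, otherwise the common value of the integrals over all
   piecewise C^1 paths in U. *)
fun form_integral ::
  "(real \<times> real) set \<Rightarrow> real \<times> real \<Rightarrow> (real \<times> real \<Rightarrow> real) \<Rightarrow> (real \<times> real \<Rightarrow> real) \<Rightarrow>
   real \<times> real \<Rightarrow> real" where
  "form_integral U (u0, v0) A1 A2 (u, v) =
     (if closed_segment (u0, v0) (u0, v) \<union> closed_segment (u0, v) (u, v) \<subseteq> U
      then (LBINT r=u0..u. A1 (r, v)) + (LBINT r=v0..v. A2 (u0, r))
      else (THE I. \<forall>\<gamma>. valid_path \<gamma> \<and> path_image \<gamma> \<subseteq> U \<and>
               pathstart \<gamma> = (u0, v0) \<and> pathfinish \<gamma> = (u, v) \<longrightarrow> line_integral A1 A2 \<gamma> = I))"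

definition involute_s :: "(real \<times> real \<Rightarrow> real) \<Rightarrow> (real \<times> real \<Rightarrow> real) \<Rightarrow> frame_map \<Rightarrow> frame_map" where
  "involute_s l \<theta> F =
     (\<lambda>p. fst F p + l p *\<^sub>R frame_vec F Dir_s p,
      \<lambda>p. frame_vec F Dir_s p,
      \<lambda>p. cos (\<theta> p) *\<^sub>R frame_vec F Dir_t p - sin (\<theta> p) *\<^sub>R frame_vec F Dir_n p)"

definition involute_t :: "(real \<times> real \<Rightarrow> real) \<Rightarrow> (real \<times> real \<Rightarrow> real) \<Rightarrow> frame_map \<Rightarrow> frame_map" where
  "involute_t l \<theta> F =
     (\<lambda>p. fst F p + l p *\<^sub>R frame_vec F Dir_t p,
      \<lambda>p. frame_vec F Dir_t p,
      \<lambda>p. cos (\<theta> p) *\<^sub>R frame_vec F Dir_n p - sin (\<theta> p) *\<^sub>R frame_vec F Dir_s p)"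

end

theory Submission
  imports Defs "HOL-Complex_Analysis.Riemann_Mapping"
begin

text \<open>
  An involute along \<open>s\<close> slides each point of the surface along \<open>s\<close> until \<open>s\<close> becomes the normal vector;
  a caustic slides each point along the normal vector, which then becomes the vector \<open>s\<close> of the new
  frame. So the caustic of an involute differs from the original surface by a displacement along \<open>s\<close>
  and has the same vector \<open>s\<close>: it is a mate, with distance \<open>\<mu> + l\<close> if \<open>l\<close> and \<open>\<mu>\<close> are the two
  displacements (\<open>mates_caustic_s_involute_s\<close>).

  Conversely, consider a mate at distance \<open>L\<close>. Its normal is a unit vector in the plane orthogonal to \<open>s\<close>,
  hence of the form \<open>sin \<phi> sI + cos \<phi> tI\<close> in the frame \<open>(s, sI, tI)\<close> of the involute. If \<open>\<phi>\<close> can be chosen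
  smooth, then the mate is the caustic with data \<open>L - l\<close> and \<open>\<phi>\<close> (\<open>mate_is_caustic_s_of_involute_s\<close>). The
  equations required of the data of a caustic say exactly that the result is a framed surface
  (\<open>caustic_s_cond_iff\<close>), and this is known for the mate.

  Two facts need that the domain is simply connected: the function \<open>l\<close> is smooth with
  \<open>dl = - (a\<^sub>1 du + a\<^sub>2 dv)\<close> (\<open>integral_of_s_component\<close>), and the smooth angle \<open>\<phi>\<close> exists (\<open>smooth_polar_angle\<close>).
  Both follow from the existence of a primitive for a closed form (\<open>closed_form_has_primitive\<close>). For the
  first, the form is closed by the hypothesis on \<open>b\<close> and \<open>g\<close>; for the second, the form is \<open>c d\<sigma> - \<sigma> dc\<close> for
  the components \<open>c\<close>, \<open>\<sigma>\<close> of the normal of the mate along \<open>tI\<close> and \<open>sI\<close>. The primitive is constructed by radial integration on a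
  convex domain (\<open>potential_on_convex\<close>) and carried over to a simply connected one by the Riemann mapping.

  The statement about \<open>t\<close> is the statement about \<open>s\<close> for the framed surface \<open>(x, n, t)\<close>. The rotation of the
  frame by a quarter turn shifts the angles by \<open>\<pi>/2\<close>.
\<close>

section \<open>Calculus of smooth functions\<close>

lemma Ck_on_cong:
  assumes "open U" "\<And>p. p \<in> U \<Longrightarrow> f p = g p" "Ck_on k U f"
  shows "Ck_on k U g"
  using assms(2,3)
proof (induction k arbitrary: f g)
  case 0
  then show ?case using continuous_on_cong[of U U f g] by simp
next
  case (Suc k)
  have D: "(g has_derivative frechet_derivative f (at p)) (at p)" if "p \<in> U" for p
    using has_derivative_transform_within_open[OF _ assms(1) that Suc.prems(1)] Suc.prems(2) that
    by (simp add: frechet_derivative_works)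
  have "Ck_on k U (\<lambda>p. frechet_derivative g (at p) h)" for h
  proof (rule Suc.IH)
    show "Ck_on k U (\<lambda>p. frechet_derivative f (at p) h)" using Suc.prems(2) by simp
  qed (metis D frechet_derivative_at)
  with D show ?case by (auto simp: differentiable_def)
qed

text \<open>\<^const>\<open>Ck_on\<close> speaks of the chosen Frechet derivative; this introduction rule admits any formula
  \<open>D\<close> for the derivative that is valid on \<open>U\<close>, so that smoothness can be proved by induction on the
  order from the usual differentiation rules.\<close>

lemma Ck_on_SucI:
  assumes "open U" "\<And>p. p \<in> U \<Longrightarrow> (f has_derivative D p) (at p)"
    and "\<And>h. Ck_on k U (\<lambda>p. D p h)"
  shows "Ck_on (Suc k) U f"
proof -
  have "Ck_on k U (\<lambda>p. frechet_derivative f (at p) h)" for h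
    by (rule Ck_on_cong[OF assms(1) _ assms(3)[of h]]) (metis assms(2) frechet_derivative_at)
  with assms(2) show ?thesis by (auto simp: differentiable_def)
qed

lemma Ck_on_Suc_imp: "Ck_on (Suc k) U f \<Longrightarrow> Ck_on k U f"
proof (induction k arbitrary: f)
  case 0
  then show ?case
    by (auto intro!: continuous_at_imp_continuous_on differentiable_imp_continuous_within)
next
  case (Suc k)
  then show ?case by (metis Ck_on.simps(2))
qed

lemma smooth_on_cong:
  "open U \<Longrightarrow> (\<And>p. p \<in> U \<Longrightarrow> f p = g p) \<Longrightarrow> smooth_on U f \<Longrightarrow> smooth_on U g"
  unfolding smooth_on_def using Ck_on_cong by blast

lemma smooth_onI:
  assumes "open U" "\<And>p. p \<in> U \<Longrightarrow> (f has_derivative D p) (at p)"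
    and "\<And>h. smooth_on U (\<lambda>p. D p h)"
  shows "smooth_on U f"
proof -
  have "Ck_on (Suc k) U f" for k
    using Ck_on_SucI[OF assms(1,2)] assms(3) unfolding smooth_on_def by blast
  then show ?thesis unfolding smooth_on_def using Ck_on_Suc_imp by blast
qed

lemma smooth_on_has_derivative:
  "smooth_on U f \<Longrightarrow> p \<in> U \<Longrightarrow> (f has_derivative frechet_derivative f (at p)) (at p)"
  unfolding smooth_on_def using Ck_on.simps(2)[of 0 U f] frechet_derivative_works by blast

lemma smooth_on_frechet_derivative:
  "smooth_on U f \<Longrightarrow> smooth_on U (\<lambda>p. frechet_derivative f (at p) h)"
  unfolding smooth_on_def by (metis Ck_on.simps(2))

lemma smooth_on_imp_continuous_on: "smooth_on U f \<Longrightarrow> continuous_on U f"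
  unfolding smooth_on_def by (metis Ck_on.simps(1))

lemma smooth_on_const:
  fixes c :: "'b::real_normed_vector"
  assumes U: "open U"
  shows "smooth_on U (\<lambda>p. c)"
proof -
  have "Ck_on k U (\<lambda>p. c)" for k and c :: 'b
  proof (induction k arbitrary: c)
    case (Suc k)
    show ?case
      by (rule Ck_on_SucI[OF U, where D = "\<lambda>_ _. 0"]) (use Suc in auto)
  qed simp
  then show ?thesis by (simp add: smooth_on_def)
qed

lemma Ck_on_add:
  assumes U: "open U" and "Ck_on k U f" "Ck_on k U g"
  shows "Ck_on k U (\<lambda>p. f p + g p)"
  using assms(2,3)
proof (induction k arbitrary: f g)
  case 0
  then show ?case by (simp add: continuous_on_add)
next
  case (Suc k)
  show ?case
  proof (rule Ck_on_SucI[OF U])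
    show "((\<lambda>p. f p + g p) has_derivative
            (\<lambda>h. frechet_derivative f (at p) h + frechet_derivative g (at p) h)) (at p)"
      if "p \<in> U" for p
      using Suc.prems that by (intro has_derivative_add) (auto simp: frechet_derivative_works[symmetric])
  qed (use Suc in auto)
qed

lemma Ck_on_bounded_bilinear:
  assumes B: "bounded_bilinear bil" and U: "open U" and "Ck_on k U f" "Ck_on k U g"
  shows "Ck_on k U (\<lambda>p. bil (f p) (g p))"
  using assms(3,4)
proof (induction k arbitrary: f g)
  case 0
  then show ?case by (simp add: bounded_bilinear.continuous_on[OF B])
next
  case (Suc k)
  show ?case
  proof (rule Ck_on_SucI[OF U])
    show "((\<lambda>p. bil (f p) (g p)) has_derivative
        (\<lambda>h. bil (f p) (frechet_derivative g (at p) h) + bil (frechet_derivative f (at p) h) (g p)))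
        (at p)" if "p \<in> U" for p
      using Suc.prems that
      by (intro bounded_bilinear.FDERIV[OF B]) (auto simp: frechet_derivative_works[symmetric])
    show "Ck_on k U (\<lambda>p. bil (f p) (frechet_derivative g (at p) h) +
            bil (frechet_derivative f (at p) h) (g p))" for h
      using Suc.prems Ck_on_Suc_imp[OF Suc.prems(1)] Ck_on_Suc_imp[OF Suc.prems(2)]
      by (intro Ck_on_add[OF U] Suc.IH) auto
  qed
qed

lemma smooth_on_add:
  "open U \<Longrightarrow> smooth_on U f \<Longrightarrow> smooth_on U g \<Longrightarrow> smooth_on U (\<lambda>p. f p + g p)"
  by (simp add: smooth_on_def Ck_on_add)

lemma smooth_on_bounded_bilinear:
  "bounded_bilinear bil \<Longrightarrow> open U \<Longrightarrow> smooth_on U f \<Longrightarrow> smooth_on U g \<Longrightarrow>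
    smooth_on U (\<lambda>p. bil (f p) (g p))"
  by (simp add: smooth_on_def Ck_on_bounded_bilinear)

lemmas smooth_on_mult = smooth_on_bounded_bilinear[OF bounded_bilinear_mult]
lemmas smooth_on_scaleR = smooth_on_bounded_bilinear[OF bounded_bilinear_scaleR]
lemmas smooth_on_inner = smooth_on_bounded_bilinear[OF bounded_bilinear_inner]

lemma bounded_bilinear_cross3: "bounded_bilinear cross3"
  by (simp add: bilinear_conv_bounded_bilinear[symmetric] bilinear_def linear_iff
      cross_add_left cross_add_right cross_mult_left cross_mult_right)

lemmas smooth_on_cross3 = smooth_on_bounded_bilinear[OF bounded_bilinear_cross3]

lemma smooth_on_minus: "open U \<Longrightarrow> smooth_on U f \<Longrightarrow> smooth_on U (\<lambda>p. - f p)"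
  using smooth_on_scaleR[OF _ smooth_on_const, of U f "-1"] by simp

lemma smooth_on_diff:
  "open U \<Longrightarrow> smooth_on U f \<Longrightarrow> smooth_on U g \<Longrightarrow> smooth_on U (\<lambda>p. f p - g p)"
  using smooth_on_add[of U f "\<lambda>p. - g p"] smooth_on_minus[of U g] by simp

lemma smooth_on_sin_cos:
  fixes \<theta> :: "'a::real_normed_vector \<Rightarrow> real"
  assumes U: "open U" and \<theta>: "smooth_on U \<theta>"
  shows "smooth_on U (\<lambda>p. sin (\<theta> p))" "smooth_on U (\<lambda>p. cos (\<theta> p))"
proof -
  let ?D = "\<lambda>p. frechet_derivative \<theta> (at p)"
  have D: "(\<theta> has_derivative ?D p) (at p)" if "p \<in> U" for p
    using smooth_on_has_derivative[OF \<theta> that] .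
  have CD: "Ck_on k U (\<lambda>p. ?D p h)" for k h
    using smooth_on_frechet_derivative[OF \<theta>] by (simp add: smooth_on_def)
  note mult = Ck_on_bounded_bilinear[OF bounded_bilinear_mult U]
  have "Ck_on k U (\<lambda>p. sin (\<theta> p)) \<and> Ck_on k U (\<lambda>p. cos (\<theta> p))" for k
  proof (induction k)
    case 0
    then show ?case
      using smooth_on_imp_continuous_on[OF \<theta>] by (auto intro: continuous_intros)
  next
    case (Suc k)
    have "Ck_on (Suc k) U (\<lambda>p. sin (\<theta> p))"
    proof (rule Ck_on_SucI[OF U])
      show "((\<lambda>p. sin (\<theta> p)) has_derivative (\<lambda>h. ?D p h * cos (\<theta> p))) (at p)" if "p \<in> U" for p
        using D[OF that] by (auto intro!: derivative_eq_intros)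
    qed (use CD Suc in \<open>auto intro: mult\<close>)
    moreover have "Ck_on (Suc k) U (\<lambda>p. cos (\<theta> p))"
    proof (rule Ck_on_SucI[OF U])
      show "((\<lambda>p. cos (\<theta> p)) has_derivative (\<lambda>h. (- 1 * ?D p h) * sin (\<theta> p))) (at p)" if "p \<in> U" for p
        using D[OF that] by (auto intro!: derivative_eq_intros)
      have "Ck_on k U (\<lambda>p. - 1 * ?D p h)" for h
        using smooth_on_const[OF U, of "-1 :: real"] CD mult unfolding smooth_on_def by blast
      then show "Ck_on k U (\<lambda>p. (- 1 * ?D p h) * sin (\<theta> p))" for h
        using Suc by (intro mult[where f = "\<lambda>p. - 1 * ?D p h"]) blast+
    qed
    ultimately show ?case ..
  qed
  then show "smooth_on U (\<lambda>p. sin (\<theta> p))" "smooth_on U (\<lambda>p. cos (\<theta> p))"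
    by (auto simp: smooth_on_def)
qed

text \<open>Schwarz's theorem. Both mixed derivatives arise by differentiating
  \<open>f (p + s h + t k) - f (p + t k)\<close>, written as an integral over \<open>[0, s]\<close>, first in \<open>t\<close> at
  \<open>t = 0\<close> under the integral sign and then in \<open>s\<close> at \<open>s = 0\<close>.\<close>

lemma mixed_derivatives_commute:
  fixes f :: "'a::real_normed_vector \<Rightarrow> 'b::banach"
  assumes U: "open U" and f: "smooth_on U f" and p: "p \<in> U"
  defines "D \<equiv> \<lambda>h q. frechet_derivative f (at q) h"
  shows "frechet_derivative (D h) (at p) k = frechet_derivative (D k) (at p) h"
proof -
  let ?DD = "\<lambda>h k q. frechet_derivative (D h) (at q) k"
  have smD: "smooth_on U (D h)" for h
    unfolding D_def by (rule smooth_on_frechet_derivative[OF f])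
  have contDD: "continuous_on U (?DD h k)" for h k
    by (rule smooth_on_imp_continuous_on[OF smooth_on_frechet_derivative[OF smD]])
  obtain \<epsilon> where \<epsilon>: "\<epsilon> > 0" "ball p \<epsilon> \<subseteq> U" using U p openE by blast
  \<comment> \<open>With this \<open>\<delta>\<close>, the parallelogram with sides \<open>2 \<delta> h\<close> and \<open>2 \<delta> k\<close> centred at \<open>p\<close> lies in the ball.\<close>
  define \<delta> where "\<delta> = \<epsilon> / (norm h + norm k + 1)"
  have den: "norm h + norm k + 1 > 0" by (smt (verit) norm_ge_zero)
  have \<delta>: "\<delta> > 0" using \<epsilon> den by (simp add: \<delta>_def)
  let ?P = "\<lambda>r t. p + r *\<^sub>R h + t *\<^sub>R k"
  have inU: "?P r t \<in> U" if "\<bar>r\<bar> \<le> \<delta>" "\<bar>t\<bar> \<le> \<delta>" for r t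
  proof -
    have "norm (r *\<^sub>R h + t *\<^sub>R k) \<le> \<delta> * norm h + \<delta> * norm k"
      using that by (intro norm_triangle_le add_mono) (auto intro: mult_right_mono)
    also have "\<dots> < \<delta> * (norm h + norm k + 1)" using \<delta> by (simp add: algebra_simps)
    also have "\<dots> = \<epsilon>" using den by (simp add: \<delta>_def)
    finally have "?P r t \<in> ball p \<epsilon>"
      by (metis add.assoc add_diff_cancel_left' dist_commute dist_norm mem_ball)
    then show ?thesis using \<epsilon> by blast
  qed
  have Dr: "((\<lambda>r. F (?P r t)) has_vector_derivative frechet_derivative F (at (?P r t)) h) (at r within X)"
    if "smooth_on U F" "\<bar>r\<bar> \<le> \<delta>" "\<bar>t\<bar> \<le> \<delta>" for F :: "'a \<Rightarrow> 'b" and r t X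
  proof -
    have "((\<lambda>r. ?P r t) has_derivative (\<lambda>r. r *\<^sub>R h)) (at r within X)"
      by (auto intro!: derivative_eq_intros)
    from has_derivative_compose[OF this smooth_on_has_derivative[OF that(1) inU[OF that(2,3)]]]
    show ?thesis
      by (simp add: has_vector_derivative_def linear_cmul[OF linear_frechet_derivative]
          differentiableI[OF smooth_on_has_derivative[OF that(1) inU[OF that(2,3)]]])
  qed
  have Dt: "((\<lambda>t. F (?P r t)) has_vector_derivative frechet_derivative F (at (?P r t)) k) (at t within X)"
    if "smooth_on U F" "\<bar>r\<bar> \<le> \<delta>" "\<bar>t\<bar> \<le> \<delta>" for F :: "'a \<Rightarrow> 'b" and r t X
  proof -
    have "((\<lambda>t. ?P r t) has_derivative (\<lambda>t. t *\<^sub>R k)) (at t within X)"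
      by (auto intro!: derivative_eq_intros)
    from has_derivative_compose[OF this smooth_on_has_derivative[OF that(1) inU[OF that(2,3)]]]
    show ?thesis
      by (simp add: has_vector_derivative_def linear_cmul[OF linear_frechet_derivative]
          differentiableI[OF smooth_on_has_derivative[OF that(1) inU[OF that(2,3)]]])
  qed
  have contG: "continuous_on ({-\<delta>..\<delta>} \<times> {0..s}) (\<lambda>(t, r). ?DD h k (?P r t))" if "s \<le> \<delta>" for s
    unfolding case_prod_beta
    by (rule continuous_on_compose2[OF contDD[of h k]]) (use inU that in \<open>auto intro!: continuous_intros\<close>)
  have contG0: "continuous_on {0..s} (\<lambda>r. ?DD h k (?P r 0))" if "s \<le> \<delta>" for s
    by (rule continuous_on_compose2[OF contDD[of h k]])
      (use inU[of _ 0] that \<delta> in \<open>auto intro!: continuous_intros\<close>)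
  have key: "D k (?P s 0) - D k (?P 0 0) = integral {0..s} (\<lambda>r. ?DD h k (?P r 0))"
    if s: "0 \<le> s" "s \<le> \<delta>" for s
  proof -
    have int: "((\<lambda>r. D h (?P r t)) has_integral f (?P s t) - f (?P 0 t)) {0..s}"
      if "t \<in> {-\<delta>..\<delta>}" for t
      unfolding D_def using s that by (intro fundamental_theorem_of_calculus Dr f) auto
    have "((\<lambda>t. integral (cbox 0 s) (\<lambda>r. D h (?P r t))) has_vector_derivative
            integral (cbox 0 s) (\<lambda>r. ?DD h k (?P r 0))) (at 0 within {-\<delta>..\<delta>})"
      using s \<delta> int contG[OF s(2)]
      by (intro leibniz_rule_vector_derivative Dt smD) (auto simp: has_integral_integrable)
    then have "((\<lambda>t. f (?P s t) - f (?P 0 t)) has_vector_derivative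
            integral (cbox 0 s) (\<lambda>r. ?DD h k (?P r 0))) (at 0 within {-\<delta>..\<delta>})"
      by (rule has_vector_derivative_transform[rotated 2])
        (use \<delta> int in \<open>auto simp: integral_unique[OF int]\<close>)
    moreover have "((\<lambda>t. f (?P s t) - f (?P 0 t)) has_vector_derivative
            D k (?P s 0) - D k (?P 0 0)) (at 0 within {-\<delta>..\<delta>})"
      unfolding D_def using s \<delta> by (intro has_vector_derivative_diff Dt f) auto
    ultimately show ?thesis
      using vector_derivative_unique_within_closed_interval[of "-\<delta>" \<delta> 0] \<delta> by auto
  qed
  have "((\<lambda>s. integral {0..s} (\<lambda>r. ?DD h k (?P r 0))) has_vector_derivative ?DD h k (?P 0 0))
          (at 0 within {0..\<delta>})"
    using \<delta> by (intro integral_has_vector_derivative contG0) auto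
  then have "((\<lambda>s. D k (?P s 0) - D k (?P 0 0)) has_vector_derivative ?DD h k (?P 0 0))
          (at 0 within {0..\<delta>})"
    by (rule has_vector_derivative_transform[rotated 2]) (use \<delta> key in auto)
  moreover have "((\<lambda>s. D k (?P s 0) - D k (?P 0 0)) has_vector_derivative ?DD k h (?P 0 0) - 0)
          (at 0 within {0..\<delta>})"
    using \<delta> by (intro has_vector_derivative_diff Dr smD has_vector_derivative_const) auto
  ultimately show ?thesis
    using vector_derivative_unique_within_closed_interval[of 0 \<delta> 0] \<delta> by auto
qed

section \<open>Potentials of closed forms\<close>

text \<open>The Poincare lemma for a vector field on a convex set: the radial integral
  \<open>F x = \<integral>\<^sub>0\<^sup>1 \<alpha> (t x) \<bullet> x dt\<close> is a potential. Differentiating under the integral sign and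
  using the symmetry of \<open>\<alpha>'\<close>, the gradient of the integrand is \<open>G x t = t \<alpha>' (t x) x + \<alpha> (t x)\<close>, which
  is the derivative of \<open>t \<alpha> (t x)\<close> in \<open>t\<close>; so its integral is \<open>\<alpha> x\<close>.\<close>

lemma potential_on_convex:
  fixes \<alpha> :: "'a::euclidean_space \<Rightarrow> 'a"
  assumes V: "open V" "convex V" "0 \<in> V"
    and D: "\<And>x. x \<in> V \<Longrightarrow> (\<alpha> has_derivative \<alpha>' x) (at x)"
    and sym: "\<And>x h k. x \<in> V \<Longrightarrow> \<alpha>' x h \<bullet> k = \<alpha>' x k \<bullet> h"
    and cont: "continuous_on (V \<times> UNIV) (\<lambda>(x, h). \<alpha>' x h)"
  obtains F where "\<And>x. x \<in> V \<Longrightarrow> (F has_derivative (\<lambda>h. \<alpha> x \<bullet> h)) (at x)"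
proof -
  define F where "F x = integral (cbox 0 1) (\<lambda>t::real. \<alpha> (t *\<^sub>R x) \<bullet> x)" for x
  define G where "G x t = t *\<^sub>R \<alpha>' (t *\<^sub>R x) x + \<alpha> (t *\<^sub>R x)" for x and t :: real
  have inV: "t *\<^sub>R x \<in> V" if "x \<in> V" "t \<in> cbox 0 1" for x and t :: real
    using convexD[OF V(2) that(1) V(3), of t "1 - t"] that by simp
  have cont\<alpha>: "continuous_on V \<alpha>"
    using D by (meson continuous_at_imp_continuous_on has_derivative_continuous)
  have lin: "linear (\<alpha>' x)" if "x \<in> V" for x
    using D[OF that] has_derivative_linear by blast
  have contG: "continuous_on (V \<times> cbox 0 1) (\<lambda>(x, t). G x t)"
  proof -
    have "continuous_on (V \<times> cbox 0 1) (\<lambda>z. (\<lambda>(x, h). \<alpha>' x h) (snd z *\<^sub>R fst z, fst z))"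
      by (rule continuous_on_compose2[OF cont]) (use inV in \<open>auto intro!: continuous_intros\<close>)
    moreover have "continuous_on (V \<times> cbox 0 1) (\<lambda>z. \<alpha> (snd z *\<^sub>R fst z))"
      by (rule continuous_on_compose2[OF cont\<alpha>]) (use inV in \<open>auto intro!: continuous_intros\<close>)
    ultimately show ?thesis
      unfolding G_def case_prod_beta by (auto intro!: continuous_intros)
  qed
  have "(F has_derivative (\<lambda>h. \<alpha> x \<bullet> h)) (at x)" if x: "x \<in> V" for x
  proof -
    have D1: "((\<lambda>x. \<alpha> (t *\<^sub>R x) \<bullet> x) has_derivative blinfun_inner_right (G x t)) (at x within V)"
      if "x \<in> V" "t \<in> cbox 0 1" for x t
    proof -
      have "((\<lambda>x. \<alpha> (t *\<^sub>R x)) has_derivative (\<lambda>h. \<alpha>' (t *\<^sub>R x) (t *\<^sub>R h))) (at x within V)"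
        by (rule has_derivative_compose[where f = "\<lambda>x. t *\<^sub>R x", OF _ D[OF inV[OF that]]])
          (auto intro!: derivative_eq_intros)
      from has_derivative_inner[OF this has_derivative_ident]
      have "((\<lambda>x. \<alpha> (t *\<^sub>R x) \<bullet> x) has_derivative
          (\<lambda>h. \<alpha> (t *\<^sub>R x) \<bullet> h + \<alpha>' (t *\<^sub>R x) (t *\<^sub>R h) \<bullet> x)) (at x within V)" .
      moreover have "\<alpha> (t *\<^sub>R x) \<bullet> h + \<alpha>' (t *\<^sub>R x) (t *\<^sub>R h) \<bullet> x = G x t \<bullet> h" for h
        using sym[OF inV[OF that], of h x]
        by (simp add: G_def inner_add_left linear_cmul[OF lin[OF inV[OF that]]])
      ultimately show ?thesis by simp
    qed
    have "continuous_on (cbox 0 1) (\<lambda>t. \<alpha> (t *\<^sub>R x))" if "x \<in> V" for x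
      by (rule continuous_on_compose2[OF cont\<alpha>]) (use inV that in \<open>auto intro!: continuous_intros\<close>)
    then have c1: "(\<lambda>t. \<alpha> (t *\<^sub>R x) \<bullet> x) integrable_on cbox 0 1" if "x \<in> V" for x
      using that by (intro integrable_continuous continuous_intros) auto
    have c2: "continuous_on (cbox 0 1) (G x)"
    proof -
      have "continuous_on (cbox 0 1) (\<lambda>t. (\<lambda>(x, t). G x t) (x, t))"
        by (rule continuous_on_compose2[OF contG]) (use x in \<open>auto intro!: continuous_intros\<close>)
      then show ?thesis by simp
    qed
    have "(F has_derivative integral (cbox 0 1) (\<lambda>t. blinfun_inner_right (G x t))) (at x within V)"
      unfolding F_def
    proof (rule leibniz_rule[OF D1])
      show "continuous_on (V \<times> cbox 0 1) (\<lambda>(x, t). blinfun_inner_right (G x t))"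
        using contG unfolding case_prod_beta
        by (rule bounded_linear.continuous_on[OF bounded_linear_blinfun_inner_right])
    qed (use c1 x V in auto)
    moreover have "integral (cbox 0 1) (\<lambda>t. blinfun_inner_right (G x t)) =
        blinfun_inner_right (integral (cbox 0 1) (G x))"
      using integral_linear[OF integrable_continuous[OF c2] bounded_linear_blinfun_inner_right]
      by (simp add: o_def)
    moreover have "(G x has_integral 1 *\<^sub>R \<alpha> (1 *\<^sub>R x) - 0 *\<^sub>R \<alpha> (0 *\<^sub>R x)) {0..1}"
    proof (rule fundamental_theorem_of_calculus)
      fix t :: real assume t: "t \<in> {0..1}"
      then have tV: "t *\<^sub>R x \<in> V" using inV x by simp
      have "((\<lambda>t. \<alpha> (t *\<^sub>R x)) has_derivative (\<lambda>h. \<alpha>' (t *\<^sub>R x) (h *\<^sub>R x))) (at t within {0..1})"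
        by (rule has_derivative_compose[where f = "\<lambda>t. t *\<^sub>R x", OF _ D[OF tV]])
          (auto intro!: derivative_eq_intros)
      then show "((\<lambda>t. t *\<^sub>R \<alpha> (t *\<^sub>R x)) has_vector_derivative G x t) (at t within {0..1})"
        unfolding has_vector_derivative_def
        by (auto intro!: derivative_eq_intros simp: G_def fun_eq_iff linear_cmul[OF lin[OF tV]]
            algebra_simps)
    qed simp
    ultimately show ?thesis
      using at_within_open[OF x V(1)] by (simp add: integral_unique fun_eq_iff)
  qed
  then show thesis by (rule that)
qed

text \<open>The Riemann mapping theorem, in the form needed for pulling back closed forms: a convex model
  \<open>V\<close> (the plane or the unit disc) with a holomorphic chart \<open>h\<close> that has a holomorphic right inverse \<open>k\<close>.\<close>

lemma simply_connected_conformal_model: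
  assumes "open S" "simply_connected S" "S \<noteq> {}"
  obtains V h k where "open V" "convex V" "(0::complex) \<in> V"
    "h holomorphic_on V" "k holomorphic_on S"
    "\<And>z. z \<in> V \<Longrightarrow> h z \<in> S" "\<And>z. z \<in> S \<Longrightarrow> k z \<in> V \<and> h (k z) = z"
proof (cases "S = UNIV")
  case True
  show thesis by (rule that[of UNIV "\<lambda>z. z" "\<lambda>z. z"]) (simp_all add: True)
next
  case False
  then obtain k h where "k holomorphic_on S" "h holomorphic_on ball 0 1"
    "\<forall>z\<in>S. k z \<in> ball 0 1 \<and> h (k z) = z" "\<forall>z\<in>ball 0 1. h z \<in> S \<and> k (h z) = z"
    using assms simply_connected_eq_biholomorphic_to_disc[OF assms(1)] by auto
  then show thesis by (intro that[of "ball 0 1" h k]) auto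
qed

text \<open>Pull the form \<open>\<alpha> \<bullet> dz\<close> back along the conformal chart \<open>h\<close>, take a potential there by
  convexity, and transport it back with \<open>k\<close>. Multiplication by \<open>h'\<close> has the adjoint multiplication by
  the conjugate of \<open>h'\<close>, so the pulled back field is \<open>\<beta> = (\<alpha> \<circ> h) cnj h'\<close>. Its derivative is again
  symmetric, because \<open>\<beta>' v \<bullet> w\<close> is the sum of \<open>\<alpha>' (h' v) \<bullet> (h' w)\<close> and \<open>\<alpha> \<bullet> (h'' v w)\<close>. This takes
  the place of a homotopy argument for path independence.\<close>

lemma potential_on_simply_connected_complex:
  fixes \<alpha> :: "complex \<Rightarrow> complex"
  assumes S: "open S" "simply_connected S"
    and D: "\<And>z. z \<in> S \<Longrightarrow> (\<alpha> has_derivative \<alpha>' z) (at z)"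
    and sym: "\<And>z v w. z \<in> S \<Longrightarrow> \<alpha>' z v \<bullet> w = \<alpha>' z w \<bullet> v"
    and cont: "continuous_on (S \<times> UNIV) (\<lambda>(z, w). \<alpha>' z w)"
  obtains F where "\<And>z. z \<in> S \<Longrightarrow> (F has_derivative (\<lambda>w. \<alpha> z \<bullet> w)) (at z)"
proof (cases "S = {}")
  case True
  then show thesis using that by auto
next
  case False
  obtain V h k where V: "open V" "convex V" "(0::complex) \<in> V"
    and holh: "h holomorphic_on V" and holk: "k holomorphic_on S"
    and hS: "\<And>z. z \<in> V \<Longrightarrow> h z \<in> S" and kV: "\<And>z. z \<in> S \<Longrightarrow> k z \<in> V \<and> h (k z) = z"
    using simply_connected_conformal_model[OF S False] by blast
  have holh': "deriv h holomorphic_on V" by (rule holomorphic_deriv[OF holh V(1)])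
  have Dh: "(h has_derivative (\<lambda>w. deriv h z * w)) (at z)" if "z \<in> V" for z
    using holomorphic_derivI[OF holh V(1) that] by (simp add: has_field_derivative_def)
  have Dh': "(deriv h has_derivative (\<lambda>w. deriv (deriv h) z * w)) (at z)" if "z \<in> V" for z
    using holomorphic_derivI[OF holh' V(1) that] by (simp add: has_field_derivative_def)
  have adj: "(a * cnj c) \<bullet> w = a \<bullet> (c * w)" for a c w :: complex
    by (simp add: inner_complex_def algebra_simps)
  define \<beta> where "\<beta> z = \<alpha> (h z) * cnj (deriv h z)" for z
  define \<beta>' where "\<beta>' z w = \<alpha>' (h z) (deriv h z * w) * cnj (deriv h z) +
      \<alpha> (h z) * cnj (deriv (deriv h) z * w)" for z w
  obtain G where G: "\<And>z. z \<in> V \<Longrightarrow> (G has_derivative (\<lambda>w. \<beta> z \<bullet> w)) (at z)"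
  proof (rule potential_on_convex[OF V])
    show "(\<beta> has_derivative \<beta>' z) (at z)" if "z \<in> V" for z
      unfolding \<beta>_def \<beta>'_def
      by (rule derivative_eq_intros has_derivative_compose[OF Dh[OF that] D[OF hS[OF that]]]
          Dh'[OF that] refl)+ (simp add: fun_eq_iff)
    show "\<beta>' z v \<bullet> w = \<beta>' z w \<bullet> v" if "z \<in> V" for z v w
    proof -
      have "\<beta>' z v \<bullet> w = \<alpha>' (h z) (deriv h z * v) \<bullet> (deriv h z * w) +
              \<alpha> (h z) \<bullet> (deriv (deriv h) z * v * w)" for v w
        unfolding \<beta>'_def inner_add_left adj ..
      then show ?thesis
        using sym[OF hS[OF that], of "deriv h z * v" "deriv h z * w"] by (simp add: mult_ac)
    qed
    have *: "continuous_on (V \<times> X) (\<lambda>p. f (fst p))" if "continuous_on V f"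
      for f :: "complex \<Rightarrow> complex" and X :: "complex set"
      by (rule continuous_on_compose2[OF that]) (auto intro!: continuous_intros)
    have ch: "continuous_on V h" "continuous_on V (deriv h)" "continuous_on V (deriv (deriv h))"
      using holh holh' holomorphic_deriv[OF holh' V(1)] by (auto intro: holomorphic_on_imp_continuous_on)
    have c\<alpha>: "continuous_on V (\<lambda>z. \<alpha> (h z))"
      by (rule continuous_on_compose2[of S \<alpha>, OF _ ch(1)])
        (use D hS in \<open>auto intro!: continuous_at_imp_continuous_on has_derivative_continuous\<close>)
    have "continuous_on (V \<times> UNIV) (\<lambda>p. (\<lambda>(z, w). \<alpha>' z w) (h (fst p), deriv h (fst p) * snd p))"
      by (rule continuous_on_compose2[OF cont])
        (use hS in \<open>auto intro!: continuous_intros * ch\<close>)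
    then show "continuous_on (V \<times> UNIV) (\<lambda>(z, w). \<beta>' z w)"
      unfolding \<beta>'_def case_prod_beta by (auto intro!: continuous_intros * ch c\<alpha>)
  qed blast
  have "((\<lambda>z. G (k z)) has_derivative (\<lambda>w. \<alpha> z \<bullet> w)) (at z)" if z: "z \<in> S" for z
  proof -
    have kz: "k z \<in> V" "h (k z) = z" using kV[OF z] by auto
    have Dk: "(k has_derivative (\<lambda>w. deriv k z * w)) (at z)"
      using holomorphic_derivI[OF holk S(1) z] by (simp add: has_field_derivative_def)
    have "((\<lambda>z. h (k z)) has_derivative (\<lambda>w. deriv h (k z) * (deriv k z * w))) (at z)"
      by (rule has_derivative_compose[OF Dk Dh[OF kz(1)]])
    moreover have "((\<lambda>z. h (k z)) has_derivative (\<lambda>w. w)) (at z)"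
      by (rule has_derivative_transform_within_open[OF has_derivative_ident S(1) z]) (use kV in auto)
    ultimately have one: "deriv h (k z) * (deriv k z * w) = w" for w
      by (metis has_derivative_unique)
    show ?thesis
      using has_derivative_compose[OF Dk G[OF kz(1)]] by (simp add: \<beta>_def adj kz(2) one)
  qed
  then show thesis by (rule that)
qed

text \<open>The same statement in the coordinates \<open>(u, v)\<close>, through the isometry \<open>K\<close> onto the complex
  plane with inverse \<open>J\<close>.\<close>

lemma potential_on_simply_connected:
  fixes \<alpha> :: "real \<times> real \<Rightarrow> real \<times> real"
  assumes U: "open U" "simply_connected U"
    and D: "\<And>p. p \<in> U \<Longrightarrow> (\<alpha> has_derivative \<alpha>' p) (at p)"
    and sym: "\<And>p h k. p \<in> U \<Longrightarrow> \<alpha>' p h \<bullet> k = \<alpha>' p k \<bullet> h"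
    and cont: "continuous_on (U \<times> UNIV) (\<lambda>(p, h). \<alpha>' p h)"
  obtains P where "\<And>p. p \<in> U \<Longrightarrow> (P has_derivative (\<lambda>h. \<alpha> p \<bullet> h)) (at p)"
proof -
  define J where "J z = (Re z, Im z)" for z
  define K where "K p = Complex (fst p) (snd p)" for p :: "real \<times> real"
  have K_eq: "K = (\<lambda>p. of_real (fst p) + \<i> * of_real (snd p))"
    by (simp add: K_def fun_eq_iff complex_eq_iff)
  have JK [simp]: "J (K p) = p" and KJ [simp]: "K (J z) = z" for p z
    by (simp_all add: J_def K_def)
  have contJ: "continuous_on X J" and contK: "continuous_on Y K" for X Y
    unfolding J_def K_eq by (auto intro!: continuous_intros)
  have DJ: "(J has_derivative J) (at z)" for z
    unfolding J_def by (auto intro!: derivative_eq_intros)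
  have DK: "(K has_derivative K) (at p)" for p
    unfolding K_eq by (auto intro!: derivative_eq_intros)
  have adj: "K p \<bullet> w = p \<bullet> J w" for p w
    by (cases p) (simp add: K_def J_def inner_complex_def)
  let ?S = "J -` U"
  have "U homeomorphic ?S"
    unfolding homeomorphic_def homeomorphism_def
    by (rule exI[of _ K], rule exI[of _ J])
      (auto intro: contJ contK image_eqI[of _ _ "K _"] image_eqI[of _ _ "J _"])
  then have S: "simply_connected ?S"
    using U(2) homeomorphic_simply_connected_eq by blast
  have oS: "open ?S" using open_vimage[OF U(1) contJ] .
  obtain F where F: "\<And>z. z \<in> ?S \<Longrightarrow> (F has_derivative (\<lambda>w. K (\<alpha> (J z)) \<bullet> w)) (at z)"
  proof (rule potential_on_simply_connected_complex[OF oS S])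
    show "((\<lambda>z. K (\<alpha> (J z))) has_derivative (\<lambda>w. K (\<alpha>' (J z) (J w)))) (at z)" if "z \<in> ?S" for z
      using has_derivative_compose[OF has_derivative_compose[OF DJ D] DK] that by simp
    show "K (\<alpha>' (J z) (J v)) \<bullet> w = K (\<alpha>' (J z) (J w)) \<bullet> v" if "z \<in> ?S" for z v w
      using sym that by (simp add: adj)
    have "continuous_on (?S \<times> UNIV) (\<lambda>q. K ((\<lambda>(p, h). \<alpha>' p h) (J (fst q), J (snd q))))"
      by (rule continuous_on_compose2[OF contK[of UNIV] continuous_on_compose2[OF cont]])
        (auto intro!: continuous_intros continuous_on_compose2[OF contJ[of UNIV]])
    then show "continuous_on (?S \<times> UNIV) (\<lambda>(z, w). K (\<alpha>' (J z) (J w)))"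
      by (simp add: case_prod_beta)
  qed blast
  have "((\<lambda>p. F (K p)) has_derivative (\<lambda>h. \<alpha> p \<bullet> h)) (at p)" if "p \<in> U" for p
    using has_derivative_compose[OF DK F[of "K p"]] that by (simp add: adj)
  then show thesis by (rule that)
qed

section \<open>Partial derivatives and integrals of closed forms\<close>

text \<open>With this vector, both cases of \<^const>\<open>partial\<close> become one directional derivative, and the two
  indices need not be treated separately.\<close>

definition coord_dir :: "nat \<Rightarrow> real \<times> real" where
  "coord_dir i = (if i = 1 then (1, 0) else (0, 1))"

lemma partial_eq_derivative:
  assumes "(f has_derivative D) (at p)"
  shows "partial i f p = D (coord_dir i)"
proof -
  have lin: "linear D" using assms by (rule has_derivative_linear)
  have D1: "D (h, 0) = h *\<^sub>R D (1, 0)" for h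
    using linear_cmul[OF lin, of h "(1, 0)"] by simp
  have D2: "D (0, h) = h *\<^sub>R D (0, 1)" for h
    using linear_cmul[OF lin, of h "(0, 1)"] by simp
  have "((\<lambda>u. f (u, snd p)) has_derivative (\<lambda>h. D (h, 0))) (at (fst p))"
    by (rule has_derivative_compose[where f = "\<lambda>u. (u, snd p)" and f' = "\<lambda>h. (h, 0)"])
      (auto simp: assms intro!: has_derivative_Pair)
  then have 1: "((\<lambda>u. f (u, snd p)) has_vector_derivative D (1, 0)) (at (fst p))"
    unfolding has_vector_derivative_def D1[symmetric] .
  have "((\<lambda>v. f (fst p, v)) has_derivative (\<lambda>h. D (0, h))) (at (snd p))"
    by (rule has_derivative_compose[where f = "\<lambda>v. (fst p, v)" and f' = "\<lambda>h. (0, h)"])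
      (auto simp: assms intro!: has_derivative_Pair)
  then have 2: "((\<lambda>v. f (fst p, v)) has_vector_derivative D (0, 1)) (at (snd p))"
    unfolding has_vector_derivative_def D2[symmetric] .
  show ?thesis
    using 1 2 by (simp add: partial_def coord_dir_def vector_derivative_at)
qed

lemma partial_eq_frechet_derivative:
  "smooth_on U f \<Longrightarrow> p \<in> U \<Longrightarrow> partial i f p = frechet_derivative f (at p) (coord_dir i)"
  by (rule partial_eq_derivative[OF smooth_on_has_derivative])

lemma has_derivative_partials:
  assumes "smooth_on U f" "p \<in> U"
  shows "(f has_derivative (\<lambda>h. fst h *\<^sub>R partial 1 f p + snd h *\<^sub>R partial 2 f p)) (at p)"
proof -
  have D: "(f has_derivative frechet_derivative f (at p)) (at p)"
    by (rule smooth_on_has_derivative[OF assms])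
  have "frechet_derivative f (at p) =
      (\<lambda>h. fst h *\<^sub>R partial 1 f p + snd h *\<^sub>R partial 2 f p)"
  proof
    fix h
    have "h = fst h *\<^sub>R (1, 0) + snd h *\<^sub>R (0, 1)" by (cases h) simp
    then have "frechet_derivative f (at p) h =
        fst h *\<^sub>R frechet_derivative f (at p) (1, 0) + snd h *\<^sub>R frechet_derivative f (at p) (0, 1)"
      using linear_add[OF has_derivative_linear[OF D]] linear_cmul[OF has_derivative_linear[OF D]]
      by metis
    then show "frechet_derivative f (at p) h = fst h *\<^sub>R partial 1 f p + snd h *\<^sub>R partial 2 f p"
      by (simp add: partial_eq_frechet_derivative[OF assms] coord_dir_def)
  qed
  with D show ?thesis by simp
qed

lemma smooth_on_partial:
  "open U \<Longrightarrow> smooth_on U f \<Longrightarrow> smooth_on U (partial i f)"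
  by (rule smooth_on_cong[OF _ _ smooth_on_frechet_derivative[where h = "coord_dir i"]])
    (simp_all add: partial_eq_frechet_derivative)

lemma partial_cong:
  assumes "open U" "p \<in> U" "\<And>q. q \<in> U \<Longrightarrow> f q = g q" "smooth_on U f"
  shows "partial i g p = partial i f p"
  using partial_eq_derivative[OF has_derivative_transform_within_open[OF
        smooth_on_has_derivative[OF assms(4,2)] assms(1,2)], of g] assms(2-4)
  by (simp add: partial_eq_frechet_derivative)

lemma partial_commute:
  fixes f :: "real \<times> real \<Rightarrow> 'b::banach"
  assumes "open U" "smooth_on U f" "p \<in> U"
  shows "partial i (partial j f) p = partial j (partial i f) p"
proof -
  note D = smooth_on_frechet_derivative[OF assms(2)]
  have "partial i (partial j f) p =
      frechet_derivative (\<lambda>q. frechet_derivative f (at q) (coord_dir j)) (at p) (coord_dir i)" for i j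
    unfolding partial_eq_frechet_derivative[OF D assms(3), symmetric]
    by (rule partial_cong[OF assms(1,3) _ D]) (simp add: partial_eq_frechet_derivative[OF assms(2)])
  then show ?thesis using mixed_derivatives_commute[OF assms] by simp
qed

lemma partial_bounded_bilinear:
  assumes "bounded_bilinear bil" "smooth_on U f" "smooth_on U g" "p \<in> U"
  shows "partial i (\<lambda>q. bil (f q) (g q)) p = bil (partial i f p) (g p) + bil (f p) (partial i g p)"
  using partial_eq_derivative[OF bounded_bilinear.FDERIV[OF assms(1)
        smooth_on_has_derivative[OF assms(2,4)] smooth_on_has_derivative[OF assms(3,4)]], of i]
  by (simp add: partial_eq_frechet_derivative[OF assms(2,4)] partial_eq_frechet_derivative[OF assms(3,4)])

lemmas partial_mult = partial_bounded_bilinear[OF bounded_bilinear_mult]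
lemmas partial_inner = partial_bounded_bilinear[OF bounded_bilinear_inner]
lemmas partial_scaleR = partial_bounded_bilinear[OF bounded_bilinear_scaleR]

lemma partial_add:
  assumes "smooth_on U f" "smooth_on U g" "p \<in> U"
  shows "partial i (\<lambda>q. f q + g q) p = partial i f p + partial i g p"
  using partial_eq_derivative[OF has_derivative_add[OF
        smooth_on_has_derivative[OF assms(1,3)] smooth_on_has_derivative[OF assms(2,3)]], of i]
  by (simp add: partial_eq_frechet_derivative[OF assms(1,3)] partial_eq_frechet_derivative[OF assms(2,3)])

lemma partial_diff:
  assumes "smooth_on U f" "smooth_on U g" "p \<in> U"
  shows "partial i (\<lambda>q. f q - g q) p = partial i f p - partial i g p"
  using partial_eq_derivative[OF has_derivative_diff[OF
        smooth_on_has_derivative[OF assms(1,3)] smooth_on_has_derivative[OF assms(2,3)]], of i]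
  by (simp add: partial_eq_frechet_derivative[OF assms(1,3)] partial_eq_frechet_derivative[OF assms(2,3)])

lemma partial_const: "partial i (\<lambda>q. c) p = 0"
  by (simp add: partial_def)

lemma closed_form_has_primitive:
  fixes A1 A2 :: "real \<times> real \<Rightarrow> real"
  assumes U: "open U" "simply_connected U" and sm: "smooth_on U A1" "smooth_on U A2"
    and closed: "\<And>p. p \<in> U \<Longrightarrow> partial 2 A1 p = partial 1 A2 p"
  obtains P where "smooth_on U P"
    "\<And>p. p \<in> U \<Longrightarrow> (P has_derivative (\<lambda>h. A1 p * fst h + A2 p * snd h)) (at p)"
proof -
  have cont: "continuous_on (U \<times> UNIV) (\<lambda>q. partial i A (fst q))" if "smooth_on U A"
    for i and A :: "real \<times> real \<Rightarrow> real"
    by (rule continuous_on_compose2[OF smooth_on_imp_continuous_on[OF smooth_on_partial[OF U(1) that]]])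
      (auto intro!: continuous_intros)
  obtain P where P: "\<And>p. p \<in> U \<Longrightarrow> (P has_derivative (\<lambda>h. (A1 p, A2 p) \<bullet> h)) (at p)"
  proof (rule potential_on_simply_connected[OF U])
    show "((\<lambda>p. (A1 p, A2 p)) has_derivative
        (\<lambda>h. (fst h *\<^sub>R partial 1 A1 p + snd h *\<^sub>R partial 2 A1 p,
              fst h *\<^sub>R partial 1 A2 p + snd h *\<^sub>R partial 2 A2 p))) (at p)" if "p \<in> U" for p
      using that sm by (intro has_derivative_Pair has_derivative_partials)
  qed (use closed sm in \<open>auto simp: inner_prod_def algebra_simps case_prod_beta
      intro!: continuous_intros cont\<close>)
  have D: "(P has_derivative (\<lambda>h. A1 p * fst h + A2 p * snd h)) (at p)" if "p \<in> U" for p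
    using P[OF that] by (simp add: inner_prod_def)
  have "smooth_on U P"
  proof (rule smooth_onI[OF U(1) D])
    show "smooth_on U (\<lambda>p. A1 p * fst h + A2 p * snd h)" for h
      by (intro smooth_on_add smooth_on_mult smooth_on_const U sm)
  qed
  then show thesis using D that by blast
qed

text \<open>Whichever clause of \<^const>\<open>form_integral\<close> applies, the fundamental theorem of calculus turns
  it into a difference of values of the primitive. The definite description is well defined because
  an open connected set contains a polynomial path between any two of its points.\<close>

lemma form_integral_primitive:
  assumes U: "open U" "connected U" and p: "p0 \<in> U" "p \<in> U"
    and cont: "continuous_on U A1" "continuous_on U A2"
    and P: "\<And>p. p \<in> U \<Longrightarrow> (P has_derivative (\<lambda>h. A1 p * fst h + A2 p * snd h)) (at p)"
  shows "form_integral U p0 A1 A2 p = P p - P p0"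
proof -
  obtain u0 v0 u v where uv: "p0 = (u0, v0)" "p = (u, v)" by (cases p0, cases p) auto
  let ?path = "closed_segment (u0, v0) (u0, v) \<union> closed_segment (u0, v) (u, v)"
  show ?thesis
  proof (cases "?path \<subseteq> U")
    case True
    have 1: "(r, v) \<in> U" if "min u0 u \<le> r" "r \<le> max u0 u" for r
    proof -
      from that have "r \<in> closed_segment u0 u" by (auto simp: closed_segment_eq_real_ivl)
      then have "(r, v) \<in> closed_segment (u0, v) (u, v)"
        by (auto simp: in_segment algebra_simps)
      with True show ?thesis by auto
    qed
    have 2: "(u0, r) \<in> U" if "min v0 v \<le> r" "r \<le> max v0 v" for r
    proof -
      from that have "r \<in> closed_segment v0 v" by (auto simp: closed_segment_eq_real_ivl)
      then have "(u0, r) \<in> closed_segment (u0, v0) (u0, v)"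
        by (auto simp: in_segment algebra_simps)
      with True show ?thesis by auto
    qed
    have "(LBINT r=u0..u. A1 (r, v)) = P (u, v) - P (u0, v)"
    proof (rule interval_integral_FTC_finite)
      show "continuous_on {min u0 u..max u0 u} (\<lambda>r. A1 (r, v))"
        by (rule continuous_on_compose2[OF cont(1)]) (use 1 in \<open>auto intro!: continuous_intros\<close>)
      show "((\<lambda>r. P (r, v)) has_vector_derivative A1 (r, v)) (at r within {min u0 u..max u0 u})"
        if "min u0 u \<le> r" "r \<le> max u0 u" for r
        using has_derivative_compose[OF has_derivative_Pair[OF has_derivative_ident has_derivative_const]
            P[OF 1[OF that]]]
        by (simp add: has_vector_derivative_def mult.commute)
    qed
    moreover have "(LBINT r=v0..v. A2 (u0, r)) = P (u0, v) - P (u0, v0)"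
    proof (rule interval_integral_FTC_finite)
      show "continuous_on {min v0 v..max v0 v} (\<lambda>r. A2 (u0, r))"
        by (rule continuous_on_compose2[OF cont(2)]) (use 2 in \<open>auto intro!: continuous_intros\<close>)
      show "((\<lambda>r. P (u0, r)) has_vector_derivative A2 (u0, r)) (at r within {min v0 v..max v0 v})"
        if "min v0 v \<le> r" "r \<le> max v0 v" for r
        using has_derivative_compose[OF has_derivative_Pair[OF has_derivative_const has_derivative_ident]
            P[OF 2[OF that]]]
        by (simp add: has_vector_derivative_def mult.commute)
    qed
    ultimately show ?thesis using True uv by simp
  next
    case False
    have LI: "line_integral A1 A2 \<gamma> = P p - P p0"
      if \<gamma>: "valid_path \<gamma>" "path_image \<gamma> \<subseteq> U" "pathstart \<gamma> = p0" "pathfinish \<gamma> = p" for \<gamma>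
    proof -
      from \<gamma>(1) obtain S where S: "finite S" "\<gamma> C1_differentiable_on ({0..1} - S)"
        and c\<gamma>: "continuous_on {0..1} \<gamma>"
        unfolding valid_path_def piecewise_C1_differentiable_on_def by auto
      have in\<gamma>: "\<gamma> r \<in> U" if "r \<in> {0..1}" for r
        using \<gamma>(2) that by (auto simp: path_image_def)
      have "((\<lambda>r. A1 (\<gamma> r) * fst (vector_derivative \<gamma> (at r)) +
              A2 (\<gamma> r) * snd (vector_derivative \<gamma> (at r))) has_integral P (\<gamma> 1) - P (\<gamma> 0)) {0..1}"
      proof (rule fundamental_theorem_of_calculus_strong[OF S(1)])
        fix r assume r: "r \<in> {0..1} - S"
        then have "(\<gamma> has_vector_derivative vector_derivative \<gamma> (at r)) (at r)"
          using S(2) by (simp add: C1_differentiable_on_eq vector_derivative_works[symmetric])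
        from has_derivative_compose[OF this[unfolded has_vector_derivative_def] P[OF in\<gamma>[of r]]] r
        show "((\<lambda>r. P (\<gamma> r)) has_vector_derivative
            A1 (\<gamma> r) * fst (vector_derivative \<gamma> (at r)) + A2 (\<gamma> r) * snd (vector_derivative \<gamma> (at r))) (at r)"
          by (simp add: has_vector_derivative_def algebra_simps)
      next
        have "continuous_on U P"
          using P by (meson continuous_at_imp_continuous_on has_derivative_continuous)
        then show "continuous_on {0..1} (\<lambda>r. P (\<gamma> r))"
          using c\<gamma> in\<gamma> by (auto intro: continuous_on_compose2)
      qed simp
      with \<gamma>(3,4) show ?thesis
        by (simp add: line_integral_def integral_unique pathstart_def pathfinish_def)
    qed
    obtain \<gamma> where \<gamma>: "polynomial_function \<gamma>" "path_image \<gamma> \<subseteq> U" "pathstart \<gamma> = p0" "pathfinish \<gamma> = p"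
      using connected_open_polynomial_connected[OF U p] by blast
    have "(THE I. \<forall>\<gamma>. valid_path \<gamma> \<and> path_image \<gamma> \<subseteq> U \<and> pathstart \<gamma> = p0 \<and> pathfinish \<gamma> = p \<longrightarrow>
        line_integral A1 A2 \<gamma> = I) = P p - P p0"
      using LI valid_path_polynomial_function[OF \<gamma>(1)] \<gamma>(2-4) by (intro the_equality) blast+
    then show ?thesis by (simp only: uv form_integral.simps False if_False)
  qed
qed

section \<open>Polar angle of a smooth map to the circle\<close>

text \<open>The angle is obtained as a primitive of
  \<open>A\<^sub>1 du + A\<^sub>2 dv = c ds - s dc\<close>. This form is closed: its differential is \<open>2 dc \<and> ds\<close>, and \<open>dc\<close>, \<open>ds\<close> are
  linearly dependent by \<open>c dc + s ds = 0\<close>. With the right constant, \<open>X = c cos \<phi> + s sin \<phi>\<close> has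
  derivative zero and equals \<open>1\<close> at one point, hence everywhere, and
  \<open>(c - cos \<phi>)\<^sup>2 + (s - sin \<phi>)\<^sup>2 = 2 - 2 X\<close>.\<close>

lemma smooth_polar_angle:
  assumes U: "open U" "connected U" "simply_connected U"
    and sm: "smooth_on U c" "smooth_on U s"
    and unit: "\<And>p. p \<in> U \<Longrightarrow> (c p)\<^sup>2 + (s p)\<^sup>2 = 1"
  obtains \<phi> :: "real \<times> real \<Rightarrow> real" where "smooth_on U \<phi>"
    "\<And>p. p \<in> U \<Longrightarrow> c p = cos (\<phi> p) \<and> s p = sin (\<phi> p)"
proof (cases "U = {}")
  case True
  then show thesis using that smooth_on_const[OF U(1)] by auto
next
  case False
  then obtain p0 where p0: "p0 \<in> U" by blast
  have tang: "c p * partial i c p + s p * partial i s p = 0" if "p \<in> U" for p i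
  proof -
    have "partial i (\<lambda>q. c q * c q + s q * s q) p = partial i (\<lambda>q. 1) p"
      using unit by (intro partial_cong[OF U(1) that] smooth_on_const U) (simp add: power2_eq_square)
    moreover have "partial i (\<lambda>q. c q * c q + s q * s q) p =
        2 * (c p * partial i c p + s p * partial i s p)"
      using that sm U(1)
      by (simp add: partial_add[of U] partial_mult[of U] smooth_on_mult)
    ultimately show ?thesis by (simp add: partial_const)
  qed
  define A where "A i p = c p * partial i s p - s p * partial i c p" for i p
  have smA: "smooth_on U (A i)" for i
    unfolding A_def using U sm by (intro smooth_on_diff smooth_on_mult smooth_on_partial)
  have dA: "partial i (A j) p = partial i c p * partial j s p - partial i s p * partial j c p +
      (c p * partial i (partial j s) p - s p * partial i (partial j c) p)" if "p \<in> U" for i j p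
    unfolding A_def using that sm U(1)
    by (simp add: partial_diff[of U] partial_mult[of U] smooth_on_mult smooth_on_partial)
  have closed: "partial 2 (A 1) p = partial 1 (A 2) p" if p: "p \<in> U" for p
  proof -
    \<comment> \<open>\<open>dc \<and> ds = 0\<close>: multiply by \<open>c\<close> and by \<open>s\<close>, which do not vanish simultaneously.\<close>
    have "c p * (partial 2 c p * partial 1 s p - partial 2 s p * partial 1 c p) = 0"
      "s p * (partial 2 c p * partial 1 s p - partial 2 s p * partial 1 c p) = 0"
      using tang[OF p, of 1] tang[OF p, of 2] by algebra+
    moreover have "c p \<noteq> 0 \<or> s p \<noteq> 0" using unit[OF p] by auto
    ultimately have "partial 2 c p * partial 1 s p - partial 2 s p * partial 1 c p = 0" by auto
    then show ?thesis
      unfolding dA[OF p] using partial_commute[OF U(1) sm(1) p, of 1 2]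
        partial_commute[OF U(1) sm(2) p, of 1 2] by (simp add: algebra_simps)
  qed
  obtain P where P: "smooth_on U P"
    "\<And>p. p \<in> U \<Longrightarrow> (P has_derivative (\<lambda>h. A 1 p * fst h + A 2 p * snd h)) (at p)"
    using closed_form_has_primitive[OF U(1,3) smA smA closed] by blast
  obtain \<phi>0 where \<phi>0: "c p0 = cos \<phi>0" "s p0 = sin \<phi>0"
    using sincos_total_2pi unit[OF p0] by metis
  define \<phi> where "\<phi> p = P p + (\<phi>0 - P p0)" for p
  have sm\<phi>: "smooth_on U \<phi>"
    unfolding \<phi>_def using U P(1) by (intro smooth_on_add smooth_on_const)
  define X where "X p = c p * cos (\<phi> p) + s p * sin (\<phi> p)" for p
  have "(X has_derivative (\<lambda>h. 0)) (at p)" if p: "p \<in> U" for p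
  proof -
    define a1 a2 where "a1 = A 1 p" and "a2 = A 2 p"
    have Dc: "partial i c p = - s p * A i p" and Ds: "partial i s p = c p * A i p" for i
      using tang[OF p, of i] unit[OF p] unfolding A_def by algebra+
    have D\<phi>: "(\<phi> has_derivative (\<lambda>h. a1 * fst h + a2 * snd h)) (at p)"
      unfolding \<phi>_def a1_def a2_def using P(2)[OF p] by (auto intro!: derivative_eq_intros)
    have "(c has_derivative (\<lambda>h. - s p * (a1 * fst h + a2 * snd h))) (at p)"
      using has_derivative_partials[OF sm(1) p] by (simp add: Dc a1_def a2_def algebra_simps)
    moreover have "(s has_derivative (\<lambda>h. c p * (a1 * fst h + a2 * snd h))) (at p)"
      using has_derivative_partials[OF sm(2) p] by (simp add: Ds a1_def a2_def algebra_simps)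
    ultimately show ?thesis
      unfolding X_def using D\<phi> by (auto intro!: derivative_eq_intros simp: fun_eq_iff algebra_simps)
  qed
  then have X: "X p = 1" if "p \<in> U" for p
    using has_derivative_zero_unique_connected[OF U(1,2), of X p0 p] that p0 \<phi>0
      unit[OF p0] by (simp add: X_def \<phi>_def power2_eq_square)
  have "c p = cos (\<phi> p) \<and> s p = sin (\<phi> p)" if p: "p \<in> U" for p
  proof -
    have "(c p - cos (\<phi> p))\<^sup>2 + (s p - sin (\<phi> p))\<^sup>2 =
        (c p)\<^sup>2 + (s p)\<^sup>2 + ((cos (\<phi> p))\<^sup>2 + (sin (\<phi> p))\<^sup>2) - 2 * X p"
      by (simp add: X_def power2_eq_square algebra_simps)
    then have "(c p - cos (\<phi> p))\<^sup>2 + (s p - sin (\<phi> p))\<^sup>2 = 0"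
      using unit[OF p] X[OF p] by simp
    then show ?thesis by (simp add: sum_power2_eq_zero_iff)
  qed
  then show thesis using that sm\<phi> by blast
qed

section \<open>Moving frames\<close>

lemma Delta_iff: "(a, b) \<in> Delta \<longleftrightarrow> a \<bullet> a = 1 \<and> b \<bullet> b = 1 \<and> a \<bullet> b = 0"
  by (auto simp: Delta_def norm_eq_1)

lemma orthonormal_frame:
  assumes "(n, s) \<in> Delta"
  defines "t \<equiv> cross3 n s"
  shows "n \<bullet> n = 1" "s \<bullet> s = 1" "t \<bullet> t = 1"
    "n \<bullet> s = 0" "s \<bullet> n = 0" "n \<bullet> t = 0" "t \<bullet> n = 0" "s \<bullet> t = 0" "t \<bullet> s = 0"
    "cross3 n t = - s"
proof -
  show o: "n \<bullet> n = 1" "s \<bullet> s = 1" "n \<bullet> s = 0" "s \<bullet> n = 0"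
    using assms by (auto simp: Delta_iff inner_commute)
  show "n \<bullet> t = 0" "t \<bullet> n = 0" "s \<bullet> t = 0" "t \<bullet> s = 0"
    by (simp_all add: t_def dot_cross_self)
  show "t \<bullet> t = 1" by (simp add: t_def dot_cross o)
  show "cross3 n t = - s" by (simp add: t_def Lagrange o)
qed

text \<open>The difference \<open>d\<close> of the two sides is orthogonal to the whole frame. By Lagrange's identity it is
  also parallel to \<open>t = n \<times> s\<close>, so it vanishes.\<close>

lemma orthonormal_expansion:
  assumes "(n, s) \<in> Delta"
  defines "t \<equiv> cross3 n s"
  shows "(w \<bullet> n) *\<^sub>R n + (w \<bullet> s) *\<^sub>R s + (w \<bullet> t) *\<^sub>R t = w"
proof -
  note o = orthonormal_frame[OF assms(1), folded t_def]
  define d where "d = w - ((w \<bullet> n) *\<^sub>R n + (w \<bullet> s) *\<^sub>R s + (w \<bullet> t) *\<^sub>R t)"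
  have perp: "d \<bullet> n = 0" "d \<bullet> s = 0" "d \<bullet> t = 0"
    by (simp_all add: d_def inner_diff_left inner_add_left o(1-9))
  then have "cross3 d t = 0" by (simp add: t_def Lagrange)
  then have "d = 0 \<or> t = 0" using perp(3) norm_and_cross_eq_0[of d t] by simp
  then have "d = 0" using o(3) by auto
  then show ?thesis by (simp add: d_def)
qed

lemma frame_vec_eqs:
  "frame_vec (x, n, s) Dir_n = n" "frame_vec (x, n, s) Dir_s = s"
  "frame_vec (x, n, s) Dir_t = (\<lambda>p. cross3 (n p) (s p))"
  by (simp_all add: fun_eq_iff)

lemma framed_surface_cong:
  assumes U: "open U"
    and eq: "\<And>p. p \<in> U \<Longrightarrow> x' p = x p \<and> n' p = n p \<and> s' p = s p"
    and F: "framed_surface U (x, n, s)"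
  shows "framed_surface U (x', n', s')"
proof -
  have "smooth_on U x'" "smooth_on U n'" "smooth_on U s'"
    using F eq smooth_on_cong[OF U, of x x'] smooth_on_cong[OF U, of n n'] smooth_on_cong[OF U, of s s']
    by auto
  moreover have "partial i x' p = partial i x p" if "p \<in> U" for i p
    using F eq by (intro partial_cong[OF U that]) auto
  ultimately show ?thesis using F eq by auto
qed

lemma inner_const_imp_partial:
  assumes U: "open U" "p \<in> U" and sm: "smooth_on U n" "smooth_on U s"
    and const: "\<And>q. q \<in> U \<Longrightarrow> n q \<bullet> s q = c"
  shows "partial i n p \<bullet> s p + n p \<bullet> partial i s p = 0"
proof -
  have "partial i (\<lambda>q. n q \<bullet> s q) p = partial i (\<lambda>q. c) p"
    using const by (intro partial_cong[OF U] smooth_on_const U) auto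
  then show ?thesis
    by (simp add: partial_inner[OF sm U(2)] partial_const)
qed

lemma framed_surface_tangent:
  assumes "framed_surface U (x, n, s)" "p \<in> U" "i \<in> {1, 2}"
  shows "partial i x p \<bullet> n p = 0"
  using assms by auto

text \<open>The invariants are the coefficients of the derivatives in the orthonormal frame; differentiating the
  orthonormality relations shows that the coefficients of \<open>n\<close>, \<open>s\<close>, \<open>t\<close> form a skew-symmetric matrix.\<close>

lemma framed_surface_has_invariants:
  assumes U: "open U" and F: "framed_surface U (x, n, s)"
  shows "\<exists>a b e f g. basic_invariants U (x, n, s) a b e f g"
proof -
  define t where "t p = cross3 (n p) (s p)" for p
  have sm: "smooth_on U x" "smooth_on U n" "smooth_on U s" using F by auto
  have smt: "smooth_on U t" unfolding t_def using U sm by (intro smooth_on_cross3)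
  have \<Delta>: "(n p, s p) \<in> Delta" if "p \<in> U" for p using F that by auto
  note o = orthonormal_frame[OF \<Delta>, folded t_def]
  have anti: "partial i m p \<bullet> l p = - (partial i l p \<bullet> m p)"
    if "p \<in> U" "smooth_on U m" "smooth_on U l" "\<And>q. q \<in> U \<Longrightarrow> m q \<bullet> l q = c" for i p c and m l :: "real \<times> real \<Rightarrow> real ^ 3"
    using inner_const_imp_partial[OF U that, of i]
    by (simp add: inner_commute[of "m p"] eq_neg_iff_add_eq_0)
  define e f g where "e i p = partial i n p \<bullet> s p" and "f i p = partial i n p \<bullet> t p"
    and "g i p = partial i s p \<bullet> t p" for i p
  have inv: "partial i n p = e i p *\<^sub>R s p + f i p *\<^sub>R t p \<and>
      partial i s p = - e i p *\<^sub>R n p + g i p *\<^sub>R t p \<and>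
      partial i t p = - f i p *\<^sub>R n p - g i p *\<^sub>R s p" if p: "p \<in> U" for i p
  proof -
    note ex = orthonormal_expansion[OF \<Delta>[OF p], folded t_def]
    have "partial i n p \<bullet> n p = 0" "partial i s p \<bullet> s p = 0" "partial i t p \<bullet> t p = 0"
      using anti[OF p sm(2) sm(2) o(1), of i] anti[OF p sm(3) sm(3) o(2), of i] anti[OF p smt smt o(3), of i]
      by auto
    moreover have "partial i s p \<bullet> n p = - e i p" "partial i t p \<bullet> n p = - f i p" "partial i t p \<bullet> s p = - g i p"
      using anti[OF p sm(3) sm(2) o(5)] anti[OF p smt sm(2) o(7)] anti[OF p smt sm(3) o(9)]
      by (auto simp: e_def f_def g_def)
    ultimately show ?thesis
      using ex[of "partial i n p"] ex[of "partial i s p"] ex[of "partial i t p"]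
      by (simp add: e_def f_def g_def)
  qed
  have invx: "partial i x p = (partial i x p \<bullet> s p) *\<^sub>R s p + (partial i x p \<bullet> t p) *\<^sub>R t p"
    if p: "p \<in> U" and "i \<in> {1, 2}" for i p
    using orthonormal_expansion[OF \<Delta>[OF p], folded t_def, of "partial i x p"]
      framed_surface_tangent[OF F p that(2)] by simp
  have "smooth_on U (\<lambda>p. partial i x p \<bullet> s p)" "smooth_on U (\<lambda>p. partial i x p \<bullet> t p)"
    "smooth_on U (e i)" "smooth_on U (f i)" "smooth_on U (g i)" for i
    unfolding e_def f_def g_def using U sm smt by - (assumption | rule smooth_on_inner smooth_on_partial)+
  then have "basic_invariants U (x, n, s) (\<lambda>i p. partial i x p \<bullet> s p) (\<lambda>i p. partial i x p \<bullet> t p) e f g"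
    unfolding basic_invariants_def Let_def frame_vec_eqs fst_conv
    using F inv invx by (fold t_def) blast
  then show ?thesis by blast
qed

lemma basic_invariantsD:
  assumes "basic_invariants U (x, n, s) a b e f g" "i \<in> {1, 2}"
  shows "smooth_on U (a i)" "smooth_on U (b i)"
    and "p \<in> U \<Longrightarrow> partial i x p = a i p *\<^sub>R s p + b i p *\<^sub>R cross3 (n p) (s p)"
    and "p \<in> U \<Longrightarrow> partial i n p = e i p *\<^sub>R s p + f i p *\<^sub>R cross3 (n p) (s p)"
    and "p \<in> U \<Longrightarrow> partial i s p = - e i p *\<^sub>R n p + g i p *\<^sub>R cross3 (n p) (s p)"
    and "p \<in> U \<Longrightarrow> partial i (\<lambda>q. cross3 (n q) (s q)) p = - f i p *\<^sub>R n p - g i p *\<^sub>R s p"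
  using assms unfolding basic_invariants_def Let_def frame_vec_eqs fst_conv by blast+

section \<open>Caustics and involutes\<close>

text \<open>The frame of a caustic is automatically orthonormal, and the normal vector \<open>m\<close> is orthogonal to \<open>n\<close>.
  So what remains of the framing condition is \<open>\<partial>\<^sub>i (x + l n) \<bullet> m = 0\<close>, and the derivative of \<open>l\<close> disappears from
  it: this is precisely the pair of equations imposed on \<open>(l, \<theta>)\<close>.\<close>

lemma framed_surface_caustic_s_iff:
  assumes U: "open U" and F: "basic_invariants U (x, n, s) a b e f g"
    and sm: "smooth_on U l" "smooth_on U \<theta>"
  shows "framed_surface U (caustic_s l \<theta> (x, n, s)) \<longleftrightarrow>
    (\<forall>i\<in>{1, 2}. \<forall>p\<in>U.
      (a i p + l p * e i p) * sin (\<theta> p) + (b i p + l p * f i p) * cos (\<theta> p) = 0)"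
proof -
  define t where "t p = cross3 (n p) (s p)" for p
  define m where "m p = sin (\<theta> p) *\<^sub>R s p + cos (\<theta> p) *\<^sub>R t p" for p
  define y where "y p = x p + l p *\<^sub>R n p" for p
  have smF: "smooth_on U x" "smooth_on U n" "smooth_on U s"
    and \<Delta>: "\<And>p. p \<in> U \<Longrightarrow> (n p, s p) \<in> Delta"
    using F unfolding basic_invariants_def by auto
  note o = orthonormal_frame[OF \<Delta>, folded t_def]
  have smt: "smooth_on U t" unfolding t_def using U smF by (intro smooth_on_cross3)
  have smm: "smooth_on U m" "smooth_on U y"
    unfolding m_def y_def
    using U smF smt sm by - (assumption | rule smooth_on_add smooth_on_scaleR smooth_on_sin_cos)+
  have \<Delta>m: "(m p, n p) \<in> Delta" if "p \<in> U" for p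
    using o(1-9)[OF that]
    by (simp add: Delta_iff m_def inner_add_left inner_add_right power2_eq_square[symmetric])
  have tangent: "partial i y p \<bullet> m p =
      (a i p + l p * e i p) * sin (\<theta> p) + (b i p + l p * f i p) * cos (\<theta> p)"
    if p: "p \<in> U" and i: "i \<in> {1, 2}" for p i
  proof -
    have "partial i y p = partial i x p + (partial i l p *\<^sub>R n p + l p *\<^sub>R partial i n p)"
      unfolding y_def using p U smF sm
      by (simp add: partial_add[of U] partial_scaleR[of U] smooth_on_scaleR)
    also have "\<dots> \<bullet> m p = (a i p + l p * e i p) * sin (\<theta> p) + (b i p + l p * f i p) * cos (\<theta> p)"
      unfolding basic_invariantsD(3,4)[OF F i p] m_def t_def[symmetric] using o(1-9)[OF p]
      by (simp add: inner_add_left inner_add_right algebra_simps)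
    finally show ?thesis .
  qed
  have "framed_surface U (caustic_s l \<theta> (x, n, s)) \<longleftrightarrow> framed_surface U (y, m, n)"
    unfolding caustic_s_def frame_vec_eqs fst_conv y_def m_def t_def ..
  also have "\<dots> \<longleftrightarrow> (\<forall>i\<in>{1, 2}. \<forall>p\<in>U. partial i y p \<bullet> m p = 0)"
    using smm smF(2) \<Delta>m by auto
  also have "\<dots> \<longleftrightarrow> (\<forall>i\<in>{1, 2}. \<forall>p\<in>U.
      (a i p + l p * e i p) * sin (\<theta> p) + (b i p + l p * f i p) * cos (\<theta> p) = 0)"
    by (intro ball_cong refl) (simp only: tangent)
  finally show ?thesis .
qed

text \<open>This removes the invariants: a caustic may be formed exactly if the resulting triple is a framed
  surface.\<close>

lemma caustic_s_cond_iff: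
  assumes U: "open U"
  shows "caustic_s_cond U l \<theta> (x, n, s) \<longleftrightarrow>
    smooth_on U l \<and> smooth_on U \<theta> \<and> framed_surface U (x, n, s) \<and>
    framed_surface U (caustic_s l \<theta> (x, n, s))"
proof
  assume "caustic_s_cond U l \<theta> (x, n, s)"
  then obtain a b e f g where sm: "smooth_on U l" "smooth_on U \<theta>"
    and F: "basic_invariants U (x, n, s) a b e f g"
    and cond: "\<forall>i\<in>{1, 2}. \<forall>p\<in>U.
      (a i p + l p * e i p) * sin (\<theta> p) + (b i p + l p * f i p) * cos (\<theta> p) = 0"
    unfolding caustic_s_cond_def by blast
  have "framed_surface U (x, n, s)" using F unfolding basic_invariants_def by blast
  with sm cond framed_surface_caustic_s_iff[OF U F sm]
  show "smooth_on U l \<and> smooth_on U \<theta> \<and> framed_surface U (x, n, s) \<and>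
      framed_surface U (caustic_s l \<theta> (x, n, s))"
    by blast
next
  assume *: "smooth_on U l \<and> smooth_on U \<theta> \<and> framed_surface U (x, n, s) \<and>
      framed_surface U (caustic_s l \<theta> (x, n, s))"
  then obtain a b e f g where "basic_invariants U (x, n, s) a b e f g"
    using framed_surface_has_invariants[OF U] by blast
  with * framed_surface_caustic_s_iff[OF U this] show "caustic_s_cond U l \<theta> (x, n, s)"
    unfolding caustic_s_cond_def by blast
qed

lemma caustic_s_cond_cong:
  assumes U: "open U" and eq: "\<And>p. p \<in> U \<Longrightarrow> x' p = x p \<and> n' p = n p \<and> s' p = s p"
  shows "caustic_s_cond U l \<theta> (x', n', s') \<longleftrightarrow> caustic_s_cond U l \<theta> (x, n, s)"
proof -
  have "framed_surface U (x', n', s') \<longleftrightarrow> framed_surface U (x, n, s)"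
    using framed_surface_cong[OF U, of x' x n' n s' s] framed_surface_cong[OF U, of x x' n n' s s'] eq
    by metis
  moreover have "framed_surface U (caustic_s l \<theta> (x', n', s')) \<longleftrightarrow>
      framed_surface U (caustic_s l \<theta> (x, n, s))"
    unfolding caustic_s_def frame_vec_eqs fst_conv
    by (rule iffI; erule framed_surface_cong[OF U, rotated]) (auto simp: eq)
  ultimately show ?thesis by (simp add: caustic_s_cond_iff[OF U])
qed

text \<open>The new normal is \<open>s\<close>, and \<open>\<partial>\<^sub>i (x + l s) \<bullet> s = \<partial>\<^sub>i x \<bullet> s + \<partial>\<^sub>i l\<close>. The hypothesis on \<open>l\<close> says that this
  vanishes.\<close>

lemma framed_surface_involute_s:
  assumes U: "open U" and F: "framed_surface U (x, n, s)"
    and sm: "smooth_on U l" "smooth_on U \<theta>"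
    and l: "\<And>p i. p \<in> U \<Longrightarrow> i \<in> {1, 2} \<Longrightarrow> partial i l p = - (partial i x p \<bullet> s p)"
  shows "framed_surface U (involute_s l \<theta> (x, n, s))"
proof -
  define t where "t p = cross3 (n p) (s p)" for p
  have smF: "smooth_on U x" "smooth_on U n" "smooth_on U s"
    and \<Delta>: "\<And>p. p \<in> U \<Longrightarrow> (n p, s p) \<in> Delta"
    using F by auto
  note o = orthonormal_frame[OF \<Delta>, folded t_def]
  have smt: "smooth_on U t" unfolding t_def using U smF by (intro smooth_on_cross3)
  define y where "y p = x p + l p *\<^sub>R s p" for p
  define r where "r p = cos (\<theta> p) *\<^sub>R t p - sin (\<theta> p) *\<^sub>R n p" for p
  have smr: "smooth_on U r" "smooth_on U y"
    unfolding r_def y_def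
    using U smF smt sm
    by - (assumption | rule smooth_on_add smooth_on_diff smooth_on_scaleR smooth_on_sin_cos)+
  have "(s p, r p) \<in> Delta" if "p \<in> U" for p
    using o(1-9)[OF that]
    by (simp add: Delta_iff r_def inner_diff_left inner_diff_right power2_eq_square[symmetric])
  moreover have "partial i y p \<bullet> s p = 0" if p: "p \<in> U" and i: "i \<in> {1, 2}" for p i
  proof -
    have "partial i s p \<bullet> s p + s p \<bullet> partial i s p = 0"
      using o(2) by (intro inner_const_imp_partial[OF U p smF(3,3)])
    then have "partial i s p \<bullet> s p = 0" by (simp add: inner_commute)
    moreover have "partial i y p = partial i x p + (partial i l p *\<^sub>R s p + l p *\<^sub>R partial i s p)"
      unfolding y_def using p U smF sm
      by (simp add: partial_add[of U] partial_scaleR[of U] smooth_on_scaleR)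
    ultimately show ?thesis using o(2)[OF p] l[OF p i] by (simp add: inner_add_left inner_diff_left)
  qed
  ultimately have "framed_surface U (y, s, r)"
    using smr smF(3) by auto
  then show ?thesis
    unfolding involute_s_def frame_vec_eqs fst_conv y_def r_def t_def .
qed

section \<open>Bertrand mates with a common tangent vector\<close>

text \<open>Both operations move the base point along the same vector field: the normal of the involute is \<open>s\<close>,
  and the caustic moves along that normal and turns it back into the vector \<open>s\<close> of its frame. The total
  displacement is \<open>(\<mu> + l) s\<close>.\<close>

lemma mates_caustic_s_involute_s:
  assumes U: "open U" and F: "framed_surface U (x, n, s)" and sm: "smooth_on U l"
    and \<mu>: "caustic_s_cond U \<mu> \<phi> (involute_s l \<theta> (x, n, s))" "densely_nonzero U (\<lambda>p. \<mu> p + l p)"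
  shows "mates U Dir_s Dir_s (x, n, s) (caustic_s \<mu> \<phi> (involute_s l \<theta> (x, n, s)))"
proof -
  have "framed_surface U (caustic_s \<mu> \<phi> (involute_s l \<theta> (x, n, s)))" "smooth_on U \<mu>"
    using \<mu>(1) unfolding involute_s_def caustic_s_cond_iff[OF U] by auto
  moreover have "smooth_on U (\<lambda>p. \<mu> p + l p)"
    using calculation U sm by (intro smooth_on_add)
  ultimately show ?thesis
    using F \<mu>(2) unfolding mates_def
    by (auto simp: caustic_s_def involute_s_def scaleR_add_left intro!: exI[of _ "\<lambda>p. \<mu> p + l p"])
qed

text \<open>Let \<open>(y, m, r)\<close> be a mate at distance \<open>L\<close>. The involute has the frame \<open>(s, sI, tI)\<close>, and \<open>m\<close> is a unit vector
  orthogonal to \<open>r = s\<close>. Hence \<open>m = sin \<phi> sI + cos \<phi> tI\<close> for a smooth polar angle \<open>\<phi>\<close>, and the mate is the caustic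
  of the involute with \<open>\<mu> = L - l\<close>.\<close>

lemma mate_is_caustic_s_of_involute_s:
  assumes U: "open U" "connected U" "simply_connected U"
    and sm: "smooth_on U l" "smooth_on U \<theta>"
    and I: "framed_surface U (involute_s l \<theta> (x, n, s))"
    and mate: "mates U Dir_s Dir_s (x, n, s) (y, m, r)"
  obtains \<mu> \<phi> where "smooth_on U \<mu>" "smooth_on U \<phi>" "densely_nonzero U (\<lambda>p. \<mu> p + l p)"
    "caustic_s_cond U \<mu> \<phi> (involute_s l \<theta> (x, n, s))"
proof -
  from mate obtain L where F: "framed_surface U (x, n, s)" and G: "framed_surface U (y, m, r)"
    and L: "smooth_on U L" "densely_nonzero U L"
    and eq: "\<And>p. p \<in> U \<Longrightarrow> y p = x p + L p *\<^sub>R s p \<and> s p = r p"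
    unfolding mates_def by auto
  define t where "t p = cross3 (n p) (s p)" for p
  define sI where "sI p = cos (\<theta> p) *\<^sub>R t p - sin (\<theta> p) *\<^sub>R n p" for p
  define tI where "tI p = cross3 (s p) (sI p)" for p
  have I_eq: "involute_s l \<theta> (x, n, s) = (\<lambda>p. x p + l p *\<^sub>R s p, s, sI)"
    unfolding involute_s_def frame_vec_eqs fst_conv sI_def t_def by (simp add: fun_eq_iff)
  have smI: "smooth_on U s" "smooth_on U sI" and \<Delta>: "\<And>p. p \<in> U \<Longrightarrow> (s p, sI p) \<in> Delta"
    using I unfolding I_eq by auto
  have smt: "smooth_on U tI" unfolding tI_def using U smI by (intro smooth_on_cross3)
  have m: "smooth_on U m" "\<And>p. p \<in> U \<Longrightarrow> (m p, s p) \<in> Delta" using G eq by auto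
  have m_eq: "m p = (m p \<bullet> sI p) *\<^sub>R sI p + (m p \<bullet> tI p) *\<^sub>R tI p" if p: "p \<in> U" for p
    using orthonormal_expansion[OF \<Delta>[OF p], folded tI_def, of "m p"] m(2)[OF p]
    by (simp add: Delta_iff)
  obtain \<phi> where \<phi>: "smooth_on U \<phi>"
    "\<And>p. p \<in> U \<Longrightarrow> m p \<bullet> tI p = cos (\<phi> p) \<and> m p \<bullet> sI p = sin (\<phi> p)"
  proof (rule smooth_polar_angle[OF U])
    show "smooth_on U (\<lambda>p. m p \<bullet> tI p)" "smooth_on U (\<lambda>p. m p \<bullet> sI p)"
      using U m(1) smt smI by (auto intro: smooth_on_inner)
    show "(m p \<bullet> tI p)\<^sup>2 + (m p \<bullet> sI p)\<^sup>2 = 1" if p: "p \<in> U" for p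
    proof -
      have "1 = m p \<bullet> ((m p \<bullet> sI p) *\<^sub>R sI p + (m p \<bullet> tI p) *\<^sub>R tI p)"
        using m(2)[OF p] m_eq[OF p] by (simp add: Delta_iff)
      then show ?thesis by (simp add: inner_add_right power2_eq_square)
    qed
  qed blast
  define \<mu> where "\<mu> p = L p - l p" for p
  have sm\<mu>: "smooth_on U \<mu>" unfolding \<mu>_def using U L sm by (intro smooth_on_diff)
  have "caustic_s \<mu> \<phi> (involute_s l \<theta> (x, n, s)) =
      (\<lambda>p. x p + l p *\<^sub>R s p + \<mu> p *\<^sub>R s p, \<lambda>p. sin (\<phi> p) *\<^sub>R sI p + cos (\<phi> p) *\<^sub>R tI p, s)"
    unfolding I_eq caustic_s_def frame_vec_eqs fst_conv tI_def by simp
  moreover have "framed_surface U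
      (\<lambda>p. x p + l p *\<^sub>R s p + \<mu> p *\<^sub>R s p, \<lambda>p. sin (\<phi> p) *\<^sub>R sI p + cos (\<phi> p) *\<^sub>R tI p, s)"
  proof (rule framed_surface_cong[OF U(1) _ G], intro conjI)
    fix p assume p: "p \<in> U"
    show "x p + l p *\<^sub>R s p + \<mu> p *\<^sub>R s p = y p"
      using eq[OF p] by (simp add: \<mu>_def scaleR_diff_left)
    show "sin (\<phi> p) *\<^sub>R sI p + cos (\<phi> p) *\<^sub>R tI p = m p"
      using m_eq[OF p] \<phi>(2)[OF p] by simp
    show "s p = r p" using eq[OF p] by blast
  qed
  ultimately have "caustic_s_cond U \<mu> \<phi> (involute_s l \<theta> (x, n, s))"
    using I sm\<mu> \<phi>(1) unfolding I_eq caustic_s_cond_iff[OF U(1)] by simp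
  moreover have "densely_nonzero U (\<lambda>p. \<mu> p + l p)" using L(2) by (simp add: \<mu>_def)
  ultimately show thesis using that sm\<mu> \<phi>(1) by blast
qed

lemma bertrand_ss_iff_caustic_of_involute:
  assumes U: "open U" "connected U" "simply_connected U" and F: "framed_surface U (x, n, s)"
    and sm: "smooth_on U l" "smooth_on U \<theta>"
    and l: "\<And>p i. p \<in> U \<Longrightarrow> i \<in> {1, 2} \<Longrightarrow> partial i l p = - (partial i x p \<bullet> s p)"
  shows "bertrand U Dir_s Dir_s (x, n, s) \<longleftrightarrow>
    (\<exists>\<mu>. smooth_on U \<mu> \<and> densely_nonzero U (\<lambda>p. \<mu> p + l p) \<and>
      (\<exists>\<phi>. smooth_on U \<phi> \<and> caustic_s_cond U \<mu> \<phi> (involute_s l \<theta> (x, n, s))))"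
proof
  assume "bertrand U Dir_s Dir_s (x, n, s)"
  then obtain y m r where "mates U Dir_s Dir_s (x, n, s) (y, m, r)"
    unfolding bertrand_def by auto
  then obtain \<mu> \<phi> where "smooth_on U \<mu>" "smooth_on U \<phi>" "densely_nonzero U (\<lambda>p. \<mu> p + l p)"
    "caustic_s_cond U \<mu> \<phi> (involute_s l \<theta> (x, n, s))"
    using mate_is_caustic_s_of_involute_s[OF U sm framed_surface_involute_s[OF U(1) F sm l]] by blast
  then show "\<exists>\<mu>. smooth_on U \<mu> \<and> densely_nonzero U (\<lambda>p. \<mu> p + l p) \<and>
      (\<exists>\<phi>. smooth_on U \<phi> \<and> caustic_s_cond U \<mu> \<phi> (involute_s l \<theta> (x, n, s)))"
    by blast
next
  assume "\<exists>\<mu>. smooth_on U \<mu> \<and> densely_nonzero U (\<lambda>p. \<mu> p + l p) \<and>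
      (\<exists>\<phi>. smooth_on U \<phi> \<and> caustic_s_cond U \<mu> \<phi> (involute_s l \<theta> (x, n, s)))"
  then show "bertrand U Dir_s Dir_s (x, n, s)"
    unfolding bertrand_def using mates_caustic_s_involute_s[OF U(1) F sm(1)] by blast
qed

text \<open>The form \<open>a\<^sub>1 du + a\<^sub>2 dv\<close> has the coefficients \<open>x\<^sub>u \<bullet> s\<close>, \<open>x\<^sub>v \<bullet> s\<close>. Since the mixed derivatives of \<open>x\<close> cancel, its
  exterior derivative comes from the derivatives of \<open>s\<close> alone and is \<open>b\<^sub>1 g\<^sub>2 - b\<^sub>2 g\<^sub>1\<close> up to sign. When this vanishes, the
  form has a primitive on the simply connected domain.\<close>

lemma integral_of_s_component:
  assumes U: "open U" "connected U" "simply_connected U" and p0: "p0 \<in> U"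
    and F: "basic_invariants U (x, n, s) a b e f g"
    and bg: "\<And>p. p \<in> U \<Longrightarrow> b 1 p * g 2 p - b 2 p * g 1 p = 0"
  defines "l \<equiv> \<lambda>p. - form_integral U p0 (a 1) (a 2) p"
  shows "smooth_on U l"
    and "\<And>p i. p \<in> U \<Longrightarrow> i \<in> {1, 2} \<Longrightarrow> partial i l p = - (partial i x p \<bullet> s p)"
proof -
  have smF: "smooth_on U x" "smooth_on U n" "smooth_on U s"
    and \<Delta>: "\<And>p. p \<in> U \<Longrightarrow> (n p, s p) \<in> Delta"
    using F unfolding basic_invariants_def by auto
  note o = orthonormal_frame(1-9)[OF \<Delta>]
  have sma: "smooth_on U (a 1)" "smooth_on U (a 2)"
    using basic_invariantsD(1)[OF F] by auto
  have a: "a i p = partial i x p \<bullet> s p" if "p \<in> U" "i \<in> {1, 2}" for i p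
    using basic_invariantsD(3)[OF F that(2,1)] o[OF that(1)] by (simp add: inner_add_left)
  have da: "partial j (a i) p = partial j (partial i x) p \<bullet> s p + b i p * g j p"
    if p: "p \<in> U" and i: "i \<in> {1, 2}" and j: "j \<in> {1, 2}" for i j p
  proof -
    have "partial j (a i) p = partial j (\<lambda>q. partial i x q \<bullet> s q) p"
      using a i smF U(1) by (intro partial_cong[OF U(1) p] smooth_on_inner smooth_on_partial) auto
    also have "\<dots> = partial j (partial i x) p \<bullet> s p + partial i x p \<bullet> partial j s p"
      using smF U(1) p by (intro partial_inner[of U] smooth_on_partial)
    also have "partial i x p \<bullet> partial j s p = b i p * g j p"
      unfolding basic_invariantsD(3)[OF F i p] basic_invariantsD(5)[OF F j p]
      using o[OF p] by (simp add: inner_add_left inner_add_right inner_diff_right)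
    finally show ?thesis .
  qed
  have closed: "partial 2 (a 1) p = partial 1 (a 2) p" if p: "p \<in> U" for p
    using bg[OF p] partial_commute[OF U(1) smF(1) p, of 1 2] by (simp add: da[OF p])
  obtain P where P: "smooth_on U P"
    "\<And>p. p \<in> U \<Longrightarrow> (P has_derivative (\<lambda>h. a 1 p * fst h + a 2 p * snd h)) (at p)"
    using closed_form_has_primitive[OF U(1,3) sma closed] by blast
  have l: "l p = P p0 - P p" if "p \<in> U" for p
    unfolding l_def using form_integral_primitive[OF U(1,2) p0 that
        sma[THEN smooth_on_imp_continuous_on] P(2)] by simp
  have smP: "smooth_on U (\<lambda>p. P p0 - P p)" using U P(1) by (intro smooth_on_diff smooth_on_const)
  then show "smooth_on U l" by (rule smooth_on_cong[OF U(1), rotated]) (simp add: l)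
  show "partial i l p = - (partial i x p \<bullet> s p)" if p: "p \<in> U" and i: "i \<in> {1, 2}" for p i
  proof -
    have "partial i l p = partial i (\<lambda>p. P p0 - P p) p"
      by (rule partial_cong[OF U(1) p _ smP]) (simp add: l)
    also have "\<dots> = - partial i P p"
      using partial_diff[OF smooth_on_const P(1) p] U(1) by (simp add: partial_const)
    also have "partial i P p = a i p"
      unfolding partial_eq_derivative[OF P(2)[OF p]] using i by (auto simp: coord_dir_def)
    finally show ?thesis using a[OF p i] by simp
  qed
qed

section \<open>Exchanging the two tangent vectors\<close>

text \<open>The rotation \<open>(n, s, t) \<mapsto> (n, t, - s)\<close> of the frame about the normal exchanges the roles of the two
  tangent vectors. It turns statements about \<open>t\<close> into statements about \<open>s\<close>.\<close>

lemma framed_surface_rotate: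
  assumes U: "open U" and F: "framed_surface U (x, n, s)"
  shows "framed_surface U (x, n, \<lambda>p. cross3 (n p) (s p))"
proof -
  have "(n p, cross3 (n p) (s p)) \<in> Delta" if "p \<in> U" for p
    using orthonormal_frame(1,3,6)[of "n p" "s p"] F that by (auto simp: Delta_iff)
  then show ?thesis using F U by (auto intro: smooth_on_cross3)
qed

lemma basic_invariants_rotate:
  assumes U: "open U" and F: "basic_invariants U (x, n, s) a b e f g"
  shows "basic_invariants U (x, n, \<lambda>p. cross3 (n p) (s p)) b (\<lambda>i p. - a i p) f (\<lambda>i p. - e i p) g"
proof -
  have fr: "framed_surface U (x, n, s)"
    and sm: "\<And>i. i \<in> {1, 2} \<Longrightarrow> smooth_on U (a i) \<and> smooth_on U (b i) \<and> smooth_on U (e i) \<and>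
      smooth_on U (f i) \<and> smooth_on U (g i)"
    using F unfolding basic_invariants_def Let_def by blast+
  have sms: "smooth_on U s" and \<Delta>: "\<And>p. p \<in> U \<Longrightarrow> (n p, s p) \<in> Delta" using fr by auto
  have t: "cross3 (n p) (cross3 (n p) (s p)) = - s p" if "p \<in> U" for p
    using orthonormal_frame(10)[OF \<Delta>[OF that]] .
  have dt: "partial i (\<lambda>p. cross3 (n p) (cross3 (n p) (s p))) p = - partial i s p" if "p \<in> U" for i p
  proof -
    have "((\<lambda>q. - s q) has_derivative (\<lambda>h. - frechet_derivative s (at p) h)) (at p)"
      by (intro has_derivative_minus smooth_on_has_derivative[OF sms that])
    from partial_eq_derivative[OF this] have "partial i (\<lambda>q. - s q) p = - partial i s p"
      by (simp add: partial_eq_frechet_derivative[OF sms that])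
    moreover have "partial i (\<lambda>p. cross3 (n p) (cross3 (n p) (s p))) p = partial i (\<lambda>q. - s q) p"
      by (rule partial_cong[OF U that]) (auto simp: t intro: smooth_on_minus U sms)
    ultimately show ?thesis by simp
  qed
  have "smooth_on U (\<lambda>p. - a i p)" "smooth_on U (\<lambda>p. - e i p)" if "i \<in> {1, 2}" for i
    using sm[OF that] by (auto intro: smooth_on_minus[OF U])
  then show ?thesis
    unfolding basic_invariants_def Let_def frame_vec_eqs fst_conv
    using framed_surface_rotate[OF U fr] sm basic_invariantsD(3-6)[OF F]
    by (simp add: t dt)
qed

lemma mates_ss_of_mates_tt:
  assumes U: "open U" and "mates U Dir_t Dir_t (x, n, s) (y, m, r)"
  shows "mates U Dir_s Dir_s (x, n, \<lambda>p. cross3 (n p) (s p)) (y, m, \<lambda>p. cross3 (m p) (r p))"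
proof -
  from assms(2) have "framed_surface U (x, n, s)" "framed_surface U (y, m, r)"
    unfolding mates_def by blast+
  from this[THEN framed_surface_rotate[OF U]] assms(2) show ?thesis
    unfolding mates_def frame_vec_eqs fst_conv by (elim conjE) (intro conjI)
qed

text \<open>The frame \<open>(m, r)\<close> is rotated back: the third vector of the frame \<open>(m, r \<times> m)\<close> is \<open>r\<close>. Equalities
  are required on \<open>U\<close> only, because away from \<open>U\<close> the vectors need not be orthonormal and the
  rotation cannot be undone there.\<close>

lemma mates_tt_of_mates_ss:
  assumes U: "open U" and F: "framed_surface U (x, n, s)"
    and mates: "mates U Dir_s Dir_s (x, n, \<lambda>p. cross3 (n p) (s p)) (y, m, r)"
    and eq: "\<And>p. p \<in> U \<Longrightarrow> y' p = y p \<and> m' p = m p \<and> r' p = cross3 (r p) (m p)"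
  shows "mates U Dir_t Dir_t (x, n, s) (y', m', r')"
proof -
  have G: "framed_surface U (y, m, r)" using mates unfolding mates_def by blast
  then have \<Delta>: "(m p, r p) \<in> Delta" if "p \<in> U" for p using that by auto
  have rm: "cross3 (r p) (m p) = - cross3 (m p) (r p)" for p by (rule cross_skew)
  have sm: "smooth_on U y" "smooth_on U m" "smooth_on U r" using G by auto
  have "framed_surface U (y, m, \<lambda>p. cross3 (r p) (m p))"
  proof -
    have "smooth_on U (\<lambda>p. cross3 (r p) (m p))" using U sm by (intro smooth_on_cross3)
    moreover have "(m p, cross3 (r p) (m p)) \<in> Delta" if "p \<in> U" for p
      using orthonormal_frame(1,3,6)[OF \<Delta>[OF that]] unfolding rm by (simp add: Delta_iff)
    ultimately show ?thesis using G by auto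
  qed
  then have "framed_surface U (y', m', r')"
    using eq by (intro framed_surface_cong[OF U, of y' y m' m r']) auto
  moreover have "cross3 (m' p) (r' p) = r p" if "p \<in> U" for p
    using eq[OF that] orthonormal_frame(10)[OF \<Delta>[OF that]] by (simp add: rm)
  moreover obtain L where L: "smooth_on U L" "densely_nonzero U L"
    "\<And>p. p \<in> U \<Longrightarrow> y p = x p + L p *\<^sub>R cross3 (n p) (s p) \<and> cross3 (n p) (s p) = r p"
    using mates unfolding mates_def frame_vec_eqs fst_conv by blast
  ultimately show ?thesis
    using F eq unfolding mates_def frame_vec_eqs fst_conv
    by (intro conjI exI[of _ L]) simp_all
qed

lemma bertrand_tt_iff_bertrand_ss:
  assumes U: "open U" and F: "framed_surface U (x, n, s)"
  shows "bertrand U Dir_t Dir_t (x, n, s) \<longleftrightarrow>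
    bertrand U Dir_s Dir_s (x, n, \<lambda>p. cross3 (n p) (s p))"
proof
  assume "bertrand U Dir_t Dir_t (x, n, s)"
  then obtain y m r where "mates U Dir_t Dir_t (x, n, s) (y, m, r)" by (auto simp: bertrand_def)
  from mates_ss_of_mates_tt[OF U this]
  show "bertrand U Dir_s Dir_s (x, n, \<lambda>p. cross3 (n p) (s p))" unfolding bertrand_def by blast
next
  assume "bertrand U Dir_s Dir_s (x, n, \<lambda>p. cross3 (n p) (s p))"
  then obtain y m r where "mates U Dir_s Dir_s (x, n, \<lambda>p. cross3 (n p) (s p)) (y, m, r)"
    by (auto simp: bertrand_def)
  then have "mates U Dir_t Dir_t (x, n, s) (y, m, \<lambda>p. cross3 (r p) (m p))"
    by (rule mates_tt_of_mates_ss[OF U F]) simp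
  then show "bertrand U Dir_t Dir_t (x, n, s)" unfolding bertrand_def by blast
qed

lemma sin_cos_shift:
  fixes y :: real
  shows "sin (y + pi / 2) = cos y" "cos (y + pi / 2) = - sin y"
    "sin (y - pi / 2) = - cos y" "cos (y - pi / 2) = sin y"
  by (simp_all add: sin_add cos_add sin_diff cos_diff)

lemma smooth_on_shift_iff:
  fixes \<theta> :: "'a::real_normed_vector \<Rightarrow> real"
  assumes U: "open U"
  shows "smooth_on U (\<lambda>p. \<theta> p + c) \<longleftrightarrow> smooth_on U \<theta>"
  using smooth_on_add[OF U _ smooth_on_const[OF U], of \<theta> c]
    smooth_on_diff[OF U _ smooth_on_const[OF U], of "\<lambda>p. \<theta> p + c" c] by auto

text \<open>The caustics with respect to \<open>s\<close> and \<open>t\<close> differ by a quarter turn of the frame, which is absorbed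
  by the angle. Their conditions then agree up to a sign.\<close>

lemma caustic_t_cond_eq:
  assumes "open U"
  shows "caustic_t_cond U l \<theta> F \<longleftrightarrow> caustic_s_cond U l (\<lambda>p. \<theta> p + pi / 2) F"
proof -
  have sign: "- A * c + B * d = 0 \<longleftrightarrow> A * c + B * - d = 0" for A B c d :: real by auto
  show ?thesis
    unfolding caustic_t_cond_def caustic_s_cond_def smooth_on_shift_iff[OF assms] sin_cos_shift sign ..
qed

text \<open>The involute along \<open>t\<close> with angle \<open>\<theta>\<close> is, on \<open>U\<close>, the involute along the second vector of the rotated
  frame \<open>(n, t)\<close> with angle \<open>\<theta> - \<pi>/2\<close>; this is the equality of their third components.\<close>

lemma involute_t_vector_rotated:
  assumes "(n p, s p) \<in> Delta"
  shows "cos (\<theta> p) *\<^sub>R n p - sin (\<theta> p) *\<^sub>R s p =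
    cos (\<theta> p + - pi / 2) *\<^sub>R cross3 (n p) (cross3 (n p) (s p)) - sin (\<theta> p + - pi / 2) *\<^sub>R n p"
  using orthonormal_frame(10)[OF assms] by (simp add: sin_cos_shift)

text \<open>Rotating the frame of the caustic with respect to \<open>s\<close> gives the caustic with respect to \<open>t\<close>, because the
  cross product of \<open>n\<close> with \<open>cos \<phi> s - sin \<phi> t\<close> is \<open>sin \<phi> s + cos \<phi> t\<close>.\<close>

lemma mates_tt_caustic_t:
  assumes U: "open U" and eq: "\<And>p. p \<in> U \<Longrightarrow> x' p = x p \<and> n' p = n p \<and> s' p = s p"
    and F: "framed_surface U (x, n, s)" and G: "framed_surface U (y, m, r)"
    and mates: "mates U Dir_s Dir_s (y, m, \<lambda>p. cross3 (m p) (r p))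
      (caustic_s \<mu> (\<lambda>p. \<phi> p + pi / 2) (x, n, s))"
  shows "mates U Dir_t Dir_t (y, m, r) (caustic_t \<mu> \<phi> (x', n', s'))"
proof -
  have "sin (\<phi> p) *\<^sub>R s' p + cos (\<phi> p) *\<^sub>R cross3 (n' p) (s' p) =
      cross3 (n p) (cos (\<phi> p) *\<^sub>R s p + - sin (\<phi> p) *\<^sub>R cross3 (n p) (s p))" if p: "p \<in> U" for p
  proof -
    have "(n p, s p) \<in> Delta" using F p by auto
    from orthonormal_frame(10)[OF this] show ?thesis
      using eq[OF p] by (simp add: cross_add_right cross_mult_right Cross3.right_diff_distrib)
  qed
  then show ?thesis
    using mates unfolding caustic_s_def caustic_t_def frame_vec_eqs fst_conv sin_cos_shift
    by (intro mates_tt_of_mates_ss[OF U G]) (auto simp: eq)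
qed

section \<open>Bertrand framed surfaces as caustics of involutes\<close>

theorem theorem4p7:
  fixes U :: "(real \<times> real) set"
    and x n s :: "real \<times> real \<Rightarrow> real ^ 3"
    and a b e f g :: "nat \<Rightarrow> real \<times> real \<Rightarrow> real"
    and u0 v0 :: real
  assumes "open U" and "connected U" and "simply_connected U"
    and "framed_surface U (x, n, s)"
    and "basic_invariants U (x, n, s) a b e f g"
    and "(u0, v0) \<in> U"
  shows
    "((\<forall>p\<in>U. b 1 p * g 2 p - b 2 p * g 1 p = 0) \<longrightarrow>
      (\<forall>\<theta>_sn. smooth_on U \<theta>_sn \<longrightarrow>
        (let lam_sn = (\<lambda>p. - form_integral U (u0, v0) (a 1) (a 2) p);
             I = involute_s lam_sn \<theta>_sn (x, n, s)
         in
          (bertrand U Dir_s Dir_s (x, n, s) \<longleftrightarrow>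
             (\<exists>lam_ns. smooth_on U lam_ns \<and> densely_nonzero U (\<lambda>p. lam_ns p + lam_sn p) \<and>
                (\<exists>\<theta>_ns. smooth_on U \<theta>_ns \<and> caustic_s_cond U lam_ns \<theta>_ns I))) \<and>
          (\<forall>lam_ns \<theta>_ns. smooth_on U lam_ns \<and> densely_nonzero U (\<lambda>p. lam_ns p + lam_sn p) \<and>
             smooth_on U \<theta>_ns \<and> caustic_s_cond U lam_ns \<theta>_ns I \<longrightarrow>
             mates U Dir_s Dir_s (x, n, s) (caustic_s lam_ns \<theta>_ns I)))))
     \<and>
     ((\<forall>p\<in>U. a 1 p * g 2 p - a 2 p * g 1 p = 0) \<longrightarrow>
      (\<forall>\<theta>_tn. smooth_on U \<theta>_tn \<longrightarrow>
        (let lam_tn = (\<lambda>p. - form_integral U (u0, v0) (b 1) (b 2) p);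
             I = involute_t lam_tn \<theta>_tn (x, n, s)
         in
          (bertrand U Dir_t Dir_t (x, n, s) \<longleftrightarrow>
             (\<exists>lam_nt. smooth_on U lam_nt \<and> densely_nonzero U (\<lambda>p. lam_nt p + lam_tn p) \<and>
                (\<exists>\<theta>_nt. smooth_on U \<theta>_nt \<and> caustic_t_cond U lam_nt \<theta>_nt I))) \<and>
          (\<forall>lam_nt \<theta>_nt. smooth_on U lam_nt \<and> densely_nonzero U (\<lambda>p. lam_nt p + lam_tn p) \<and>
             smooth_on U \<theta>_nt \<and> caustic_t_cond U lam_nt \<theta>_nt I \<longrightarrow>
             mates U Dir_t Dir_t (x, n, s) (caustic_t lam_nt \<theta>_nt I)))))"
proof (intro conjI impI allI)
  note U = assms(1-3) and F = assms(4) and inv = assms(5) and p0 = assms(6)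
  fix \<theta> :: "real \<times> real \<Rightarrow> real" assume \<theta>: "smooth_on U \<theta>"
  {
    assume "\<forall>p\<in>U. b 1 p * g 2 p - b 2 p * g 1 p = 0"
    then have bg: "b 1 p * g 2 p - b 2 p * g 1 p = 0" if "p \<in> U" for p using that by blast
    note l = integral_of_s_component[OF U p0 inv bg]
    show "let l = (\<lambda>p. - form_integral U (u0, v0) (a 1) (a 2) p); I = involute_s l \<theta> (x, n, s) in
      (bertrand U Dir_s Dir_s (x, n, s) \<longleftrightarrow>
         (\<exists>\<mu>. smooth_on U \<mu> \<and> densely_nonzero U (\<lambda>p. \<mu> p + l p) \<and>
            (\<exists>\<phi>. smooth_on U \<phi> \<and> caustic_s_cond U \<mu> \<phi> I))) \<and>
      (\<forall>\<mu> \<phi>. smooth_on U \<mu> \<and> densely_nonzero U (\<lambda>p. \<mu> p + l p) \<and>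
         smooth_on U \<phi> \<and> caustic_s_cond U \<mu> \<phi> I \<longrightarrow>
         mates U Dir_s Dir_s (x, n, s) (caustic_s \<mu> \<phi> I))"
      unfolding Let_def
      using bertrand_ss_iff_caustic_of_involute[OF U F l(1) \<theta> l(2)]
        mates_caustic_s_involute_s[OF U(1) F l(1)] by blast
  next
    let ?t = "\<lambda>p. cross3 (n p) (s p)"
    assume ag: "\<forall>p\<in>U. a 1 p * g 2 p - a 2 p * g 1 p = 0"
    define l where "l = (\<lambda>p. - form_integral U (u0, v0) (b 1) (b 2) p)"
    \<comment> \<open>Second part: apply the first part to the rotated framed surface \<open>(x, n, t)\<close>, whose invariants
      are \<open>b, - a, f, - e, g\<close>.\<close>
    define \<theta>' where "\<theta>' = (\<lambda>p. \<theta> p + - pi / 2)"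
    have \<theta>': "smooth_on U \<theta>'" unfolding \<theta>'_def smooth_on_shift_iff[OF U(1)] by (rule \<theta>)
    have F': "framed_surface U (x, n, ?t)" by (rule framed_surface_rotate[OF U(1) F])
    have "- a 1 p * g 2 p - - a 2 p * g 1 p = 0" if "p \<in> U" for p using ag that by simp
    note l = integral_of_s_component[OF U p0 basic_invariants_rotate[OF U(1) inv] this, folded l_def]
    let ?I = "involute_t l \<theta> (x, n, s)" and ?J = "involute_s l \<theta>' (x, n, ?t)"
    have IJ: "(\<lambda>p. x p + l p *\<^sub>R ?t p) p = (\<lambda>p. x p + l p *\<^sub>R ?t p) p \<and> ?t p = ?t p \<and>
        cos (\<theta> p) *\<^sub>R n p - sin (\<theta> p) *\<^sub>R s p =
        cos (\<theta>' p) *\<^sub>R cross3 (n p) (?t p) - sin (\<theta>' p) *\<^sub>R n p" if "p \<in> U" for p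
      unfolding \<theta>'_def using involute_t_vector_rotated[of n p s \<theta>] F that by simp
    have I_cond: "caustic_t_cond U \<mu> \<phi> ?I \<longleftrightarrow> caustic_s_cond U \<mu> (\<lambda>p. \<phi> p + pi / 2) ?J" for \<mu> \<phi>
      unfolding caustic_t_cond_eq[OF U(1)] involute_t_def involute_s_def frame_vec_eqs fst_conv
      by (rule caustic_s_cond_cong[OF U(1) IJ])
    have ex: "(\<exists>\<phi>. smooth_on U \<phi> \<and> caustic_t_cond U \<mu> \<phi> ?I) \<longleftrightarrow>
        (\<exists>\<phi>. smooth_on U \<phi> \<and> caustic_s_cond U \<mu> \<phi> ?J)" for \<mu>
    proof
      assume "\<exists>\<phi>. smooth_on U \<phi> \<and> caustic_t_cond U \<mu> \<phi> ?I"
      then show "\<exists>\<phi>. smooth_on U \<phi> \<and> caustic_s_cond U \<mu> \<phi> ?J"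
        unfolding I_cond using smooth_on_shift_iff[OF U(1)] by blast
    next
      assume "\<exists>\<phi>. smooth_on U \<phi> \<and> caustic_s_cond U \<mu> \<phi> ?J"
      then obtain \<phi> where "smooth_on U \<phi>" "caustic_s_cond U \<mu> \<phi> ?J" by blast
      then have "smooth_on U (\<lambda>p. \<phi> p + - (pi / 2)) \<and>
          caustic_s_cond U \<mu> (\<lambda>p. (\<phi> p + - (pi / 2)) + pi / 2) ?J"
        unfolding smooth_on_shift_iff[OF U(1)] by simp
      then show "\<exists>\<phi>. smooth_on U \<phi> \<and> caustic_t_cond U \<mu> \<phi> ?I"
        unfolding I_cond by (intro exI)
    qed
    have "mates U Dir_t Dir_t (x, n, s) (caustic_t \<mu> \<phi> ?I)"
      if "densely_nonzero U (\<lambda>p. \<mu> p + l p)" "caustic_t_cond U \<mu> \<phi> ?I" for \<mu> \<phi>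
    proof -
      have "mates U Dir_s Dir_s (x, n, ?t) (caustic_s \<mu> (\<lambda>p. \<phi> p + pi / 2) ?J)"
        using that unfolding I_cond by (intro mates_caustic_s_involute_s[OF U(1) F' l(1)])
      with framed_surface_involute_s[OF U(1) F' l(1) \<theta>' l(2)] show ?thesis
        unfolding involute_t_def involute_s_def frame_vec_eqs fst_conv
        using IJ F by (intro mates_tt_caustic_t[OF U(1)])
    qed
    with bertrand_tt_iff_bertrand_ss[OF U(1) F]
      bertrand_ss_iff_caustic_of_involute[OF U F' l(1) \<theta>' l(2)]
    show "let l = (\<lambda>p. - form_integral U (u0, v0) (b 1) (b 2) p); I = involute_t l \<theta> (x, n, s) in
      (bertrand U Dir_t Dir_t (x, n, s) \<longleftrightarrow>
         (\<exists>\<mu>. smooth_on U \<mu> \<and> densely_nonzero U (\<lambda>p. \<mu> p + l p) \<and>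
            (\<exists>\<phi>. smooth_on U \<phi> \<and> caustic_t_cond U \<mu> \<phi> I))) \<and>
      (\<forall>\<mu> \<phi>. smooth_on U \<mu> \<and> densely_nonzero U (\<lambda>p. \<mu> p + l p) \<and>
         smooth_on U \<phi> \<and> caustic_t_cond U \<mu> \<phi> I \<longrightarrow>
         mates U Dir_t Dir_t (x, n, s) (caustic_t \<mu> \<phi> I))"
      unfolding Let_def l_def[symmetric] ex by blast
  }
qed

end
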